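(* Let $\mathbb{F}$ be a field of prime characteristic $p>0$, let $R=\mathbb{F}[u,v,w,x,y,z]$ be the polynomial ring in six indeterminates, let $\mathfrak{m}=(u,v,w,x,y,z)$, and let $I=(vz-wy,\ wx-uz,\ uy-vx)$ be the ideal generated by the size two minors of $\begin{bmatrix} u & v & w\\ x & y & z\end{bmatrix}$. Let $t\geq 2$ be an integer, let $q$ be the largest power of $p$ such that $q\leq t-1$, and let $q_2$ be the smallest power of $p$ such that $q+q_2\geq t$. Further, suppose that $m$ is a positive integer with $0<m\leq q$ such that $q_2\mid m$. Then $$\operatorname{rank} H^3_{\mathfrak{m}}(R/I^t)_0\ \geq\ 2\left\lfloor \frac{q}{q_2}\right\rfloor-1 .$$ In particular, whenever $t=p^e+1$ for some $e$, the rank of $H^3_{\mathfrak{m}}(R/I^t)_0$ is at least $2t-1$.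
   Context: $R$ has the standard grading. $H^3_{\mathfrak{m}}(R/I^t)_0$ is the degree-$0$ component of the third local cohomology module of $R/I^t$ supported at $\mathfrak{m}$, and rank means dimension as an $\mathbb{F}$-vector space. Powers of $p$ are the integers $p^i$ with $i\geq 0$, so $1=p^0$ is allowed. The integer $m$ does not occur in the conclusion; in the proof it indexes the cohomology classes that are constructed.
   Formalization: In the "in particular" clause for t = p^e + 1 the bound 2t−1 is replaced by 2t−3, which is what the general bound gives; 2t−1 is false, e.g. for t = 2 the rank is exactly 1. *)

theory Defs
  imports
    "HOL-Algebra.Algebraic_Closure_Type"
    "HOL-Algebra.Ideal_Product"
    "HOL-Algebra.QuotRing"
    "HOL-Library.Poly_Mapping"
    "HOL-Library.Extended_Nat"
    "Jordan_Normal_Form.Missing_VectorSpace"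
begin

section \<open>Polynomials in six indeterminates\<close>

datatype indet = Iu | Iv | Iw | Ix | Iy | Iz

type_synonym 'a poly6 = "(indet \<Rightarrow>\<^sub>0 nat) \<Rightarrow>\<^sub>0 'a"

definition Var :: "indet \<Rightarrow> 'a::comm_ring_1 poly6" where
  "Var i = Poly_Mapping.single (Poly_Mapping.single i 1) 1"

definition Const :: "'a::comm_ring_1 \<Rightarrow> 'a poly6" where
  "Const c = Poly_Mapping.single 0 c"

definition monom_degree :: "(indet \<Rightarrow>\<^sub>0 nat) \<Rightarrow> nat" where
  "monom_degree e = (\<Sum>i\<in>Poly_Mapping.keys e. Poly_Mapping.lookup e i)"

text \<open>The graded piece of degree \<open>d\<close> for the standard grading. It is \<open>{0}\<close> for negative \<open>d\<close>;
  degrees are integers because those of fractions are.\<close>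

definition homogeneous :: "int \<Rightarrow> 'a::comm_ring_1 poly6 set" where
  "homogeneous d = {p. \<forall>e\<in>Poly_Mapping.keys p. int (monom_degree e) = d}"


section \<open>Quotient rings as modules\<close>

text \<open>Records of type \<^typ>\<open>('r, 'm) module\<close> also have the ring fields \<open>mult\<close> and \<open>one\<close>, which
  play no role for modules and are left undefined throughout.\<close>

definition quotient_module ::
    "('r, 'c) ring_scheme \<Rightarrow> 'r set \<Rightarrow> ('r, 'r set) module" where
  "quotient_module R J =
    \<lparr>carrier = carrier (R Quot J), monoid.mult = undefined, monoid.one = undefined,
     ring.zero = \<zero>\<^bsub>R Quot J\<^esub>, ring.add = (\<lambda>A B. A \<oplus>\<^bsub>R Quot J\<^esub> B),
     module.smult = (\<lambda>r A. (J +>\<^bsub>R\<^esub> r) \<otimes>\<^bsub>R Quot J\<^esub> A)\<rparr>"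


section \<open>Localisation of a module at the powers of an element\<close>

text \<open>\<open>frac R M f a n\<close> is the fraction \<open>a / f\<^sup>n\<close> in \<open>M\<^sub>f\<close>, as the set of all pairs \<open>(b, k)\<close> with
  \<open>b / f\<^sup>k = a / f\<^sup>n\<close>.\<close>

definition frac ::
    "('r, 'c) ring_scheme \<Rightarrow> ('r, 'm, 'd) module_scheme \<Rightarrow> 'r \<Rightarrow> 'm \<Rightarrow> nat \<Rightarrow> ('m \<times> nat) set" where
  "frac R M f a n =
    {(b, k). b \<in> carrier M \<and>
       (\<exists>l::nat. (f [^]\<^bsub>R\<^esub> (l + k)) \<odot>\<^bsub>M\<^esub> a = (f [^]\<^bsub>R\<^esub> (l + n)) \<odot>\<^bsub>M\<^esub> b)}"

text \<open>The operations are defined on representatives; the unions run over all representatives,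
  which give the same fraction.\<close>

definition localisation ::
    "('r, 'c) ring_scheme \<Rightarrow> ('r, 'm, 'd) module_scheme \<Rightarrow> 'r \<Rightarrow> ('r, ('m \<times> nat) set) module" where
  "localisation R M f =
    \<lparr>carrier = {frac R M f a n | a n. a \<in> carrier M}, monoid.mult = undefined, monoid.one = undefined,
     ring.zero = frac R M f \<zero>\<^bsub>M\<^esub> 0,
     ring.add = (\<lambda>A B. \<Union>(a, n)\<in>A. \<Union>(b, k)\<in>B.
       frac R M f ((f [^]\<^bsub>R\<^esub> k) \<odot>\<^bsub>M\<^esub> a \<oplus>\<^bsub>M\<^esub> (f [^]\<^bsub>R\<^esub> n) \<odot>\<^bsub>M\<^esub> b) (n + k)),
     module.smult = (\<lambda>r A. \<Union>(a, n)\<in>A. frac R M f (r \<odot>\<^bsub>M\<^esub> a) n)\<rparr>"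

text \<open>The canonical map \<open>M\<^sub>g \<rightarrow> M\<^bsub>gh\<^esub>\<close>, sending \<open>a / g\<^sup>n\<close> to \<open>h\<^sup>n a / (gh)\<^sup>n\<close>.\<close>

definition localisation_map ::
    "('r, 'c) ring_scheme \<Rightarrow> ('r, 'm, 'd) module_scheme \<Rightarrow> 'r \<Rightarrow> 'r \<Rightarrow>
     ('m \<times> nat) set \<Rightarrow> ('m \<times> nat) set" where
  "localisation_map R M g h A =
    (\<Union>(a, n)\<in>A. frac R M (g \<otimes>\<^bsub>R\<^esub> h) ((h [^]\<^bsub>R\<^esub> n) \<odot>\<^bsub>M\<^esub> a) n)"


section \<open>Local cohomology\<close>

text \<open>The Cech complex of \<open>M\<close> on \<open>fs = [f\<^sub>0, \<dots>, f\<^bsub>s-1\<^esub>]\<close> has as its term in cohomological degree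
  \<open>k\<close> the direct sum of the localisations of \<open>M\<close> at the products of \<open>k\<close> distinct entries.\<close>

definition cech_index :: "'r list \<Rightarrow> nat \<Rightarrow> nat set set" where
  "cech_index fs k = {\<sigma>. \<sigma> \<subseteq> {..<length fs} \<and> card \<sigma> = k}"

definition cech_prod :: "('r, 'c) ring_scheme \<Rightarrow> 'r list \<Rightarrow> nat set \<Rightarrow> 'r" where
  "cech_prod R fs \<sigma> = finprod R (\<lambda>i. fs ! i) \<sigma>"

definition cech_loc ::
    "('r, 'c) ring_scheme \<Rightarrow> 'r list \<Rightarrow> ('r, 'm, 'd) module_scheme \<Rightarrow> nat set \<Rightarrow>
     ('r, ('m \<times> nat) set) module" where
  "cech_loc R fs M \<sigma> = localisation R M (cech_prod R fs \<sigma>)"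

definition cech ::
    "('r, 'c) ring_scheme \<Rightarrow> 'r list \<Rightarrow> ('r, 'm, 'd) module_scheme \<Rightarrow> nat \<Rightarrow>
     ('r, nat set \<Rightarrow> ('m \<times> nat) set) module" where
  "cech R fs M k =
    \<lparr>carrier = (\<Pi>\<^sub>E \<sigma>\<in>cech_index fs k. carrier (cech_loc R fs M \<sigma>)),
     monoid.mult = undefined, monoid.one = undefined,
     ring.zero = (\<lambda>\<sigma>\<in>cech_index fs k. \<zero>\<^bsub>cech_loc R fs M \<sigma>\<^esub>),
     ring.add = (\<lambda>c c'. \<lambda>\<sigma>\<in>cech_index fs k. c \<sigma> \<oplus>\<^bsub>cech_loc R fs M \<sigma>\<^esub> c' \<sigma>),
     module.smult = (\<lambda>r c. \<lambda>\<sigma>\<in>cech_index fs k. r \<odot>\<^bsub>cech_loc R fs M \<sigma>\<^esub> c \<sigma>)\<rparr>"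

definition cech_diff ::
    "('r, 'c) ring_scheme \<Rightarrow> 'r list \<Rightarrow> ('r, 'm, 'd) module_scheme \<Rightarrow> nat \<Rightarrow>
     (nat set \<Rightarrow> ('m \<times> nat) set) \<Rightarrow> nat set \<Rightarrow> ('m \<times> nat) set" where
  "cech_diff R fs M k c =
    (\<lambda>\<tau>\<in>cech_index fs (Suc k).
       \<Oplus>\<^bsub>cech_loc R fs M \<tau>\<^esub> i\<in>\<tau>.
         ((\<ominus>\<^bsub>R\<^esub> \<one>\<^bsub>R\<^esub>) [^]\<^bsub>R\<^esub> card {j \<in> \<tau>. j < i}) \<odot>\<^bsub>cech_loc R fs M \<tau>\<^esub>
           localisation_map R M (cech_prod R fs (\<tau> - {i})) (fs ! i) (c (\<tau> - {i})))"

definition cech_cocycles ::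
    "('r, 'c) ring_scheme \<Rightarrow> 'r list \<Rightarrow> ('r, 'm, 'd) module_scheme \<Rightarrow> nat \<Rightarrow>
     (nat set \<Rightarrow> ('m \<times> nat) set) set" where
  "cech_cocycles R fs M k =
    {c \<in> carrier (cech R fs M k). cech_diff R fs M k c = \<zero>\<^bsub>cech R fs M (Suc k)\<^esub>}"

definition cech_coboundaries ::
    "('r, 'c) ring_scheme \<Rightarrow> 'r list \<Rightarrow> ('r, 'm, 'd) module_scheme \<Rightarrow> nat \<Rightarrow>
     (nat set \<Rightarrow> ('m \<times> nat) set) set" where
  "cech_coboundaries R fs M k =
    (case k of 0 \<Rightarrow> {\<zero>\<^bsub>cech R fs M 0\<^esub>}
     | Suc k' \<Rightarrow> cech_diff R fs M k' ` carrier (cech R fs M k'))"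

text \<open>For a Noetherian ring \<open>R\<close> this is the local cohomology module of \<open>M\<close> supported at the ideal
  generated by \<open>fs\<close>, defined as the cohomology of the Cech complex.\<close>

definition local_cohomology ::
    "('r, 'c) ring_scheme \<Rightarrow> 'r list \<Rightarrow> ('r, 'm, 'd) module_scheme \<Rightarrow> nat \<Rightarrow>
     ('r, (nat set \<Rightarrow> ('m \<times> nat) set) set) module" where
  "local_cohomology R fs M k =
    \<lparr>carrier = {cech_coboundaries R fs M k +>\<^bsub>cech R fs M k\<^esub> z | z. z \<in> cech_cocycles R fs M k},
     monoid.mult = undefined, monoid.one = undefined,
     ring.zero = cech_coboundaries R fs M k,
     ring.add = (\<lambda>A B. A <+>\<^bsub>cech R fs M k\<^esub> B),
     module.smult = (\<lambda>r A. \<Union>z\<in>A. cech_coboundaries R fs M k +>\<^bsub>cech R fs M k\<^esub> (r \<odot>\<^bsub>cech R fs M k\<^esub> z))\<rparr>"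


section \<open>Graded pieces and rank\<close>

text \<open>Let \<open>M\<close> be graded with pieces \<open>G d\<close>, and let all entries of \<open>fs\<close> be homogeneous of degree one.
  Then the product belonging to \<open>\<sigma>\<close> has degree \<open>card \<sigma>\<close>, and the fraction \<open>a / f\<^sup>n\<close> at \<open>\<sigma>\<close> has
  degree \<open>deg a - n * card \<sigma>\<close>. The differential preserves degrees.\<close>

definition cech_piece ::
    "('r, 'c) ring_scheme \<Rightarrow> 'r list \<Rightarrow> ('r, 'm, 'd) module_scheme \<Rightarrow> (int \<Rightarrow> 'm set) \<Rightarrow>
     nat \<Rightarrow> int \<Rightarrow> (nat set \<Rightarrow> ('m \<times> nat) set) set" where
  "cech_piece R fs M G k d =
    (\<Pi>\<^sub>E \<sigma>\<in>cech_index fs k.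
       {frac R M (cech_prod R fs \<sigma>) a n | a n. a \<in> G (d + int n * int (card \<sigma>))})"

definition local_cohomology_piece ::
    "('r, 'c) ring_scheme \<Rightarrow> 'r list \<Rightarrow> ('r, 'm, 'd) module_scheme \<Rightarrow> (int \<Rightarrow> 'm set) \<Rightarrow>
     nat \<Rightarrow> int \<Rightarrow> (nat set \<Rightarrow> ('m \<times> nat) set) set set" where
  "local_cohomology_piece R fs M G k d =
    {cech_coboundaries R fs M k +>\<^bsub>cech R fs M k\<^esub> z | z.
       z \<in> cech_cocycles R fs M k \<inter> cech_piece R fs M G k d}"

text \<open>A subset \<open>S\<close> of an \<open>R\<close>-module, closed under addition and under the scalars \<open>\<phi> c\<close>, as a
  module over the domain of \<open>\<phi>\<close>.\<close>

definition restrict_scalars ::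
    "('k \<Rightarrow> 'r) \<Rightarrow> ('r, 'm, 'd) module_scheme \<Rightarrow> 'm set \<Rightarrow> ('k, 'm) module" where
  "restrict_scalars \<phi> M S =
    \<lparr>carrier = S, monoid.mult = undefined, monoid.one = undefined, ring.zero = \<zero>\<^bsub>M\<^esub>,
     ring.add = (\<lambda>x y. x \<oplus>\<^bsub>M\<^esub> y), module.smult = (\<lambda>c x. \<phi> c \<odot>\<^bsub>M\<^esub> x)\<rparr>"

text \<open>The library's \<open>vectorspace.dim\<close> is meaningful only in the finite-dimensional case.\<close>

definition vs_rank :: "('k, 'c) ring_scheme \<Rightarrow> ('k, 'm, 'd) module_scheme \<Rightarrow> enat" where
  "vs_rank K V = (if vectorspace.fin_dim K V then enat (vectorspace.dim K V) else \<infinity>)"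


section \<open>The ideal of size two minors and its powers\<close>

abbreviation poly6_ring :: "'a::field poly6 ring" where
  "poly6_ring \<equiv> ring_of_type_algebra"

definition minors_ideal :: "'a::field poly6 set" where
  "minors_ideal = genideal poly6_ring
    {Var Iv * Var Iz - Var Iw * Var Iy,
     Var Iw * Var Ix - Var Iu * Var Iz,
     Var Iu * Var Iy - Var Iv * Var Ix}"

text \<open>\<open>R / I\<^sup>t\<close> as an \<open>R\<close>-module, and its grading induced by that of \<open>R\<close>.\<close>

definition thickening :: "nat \<Rightarrow> ('a::field poly6, 'a poly6 set) module" where
  "thickening t =
    quotient_module poly6_ring (minors_ideal [^]\<^bsub>ideals_set poly6_ring\<^esub> t)"

definition thickening_piece :: "nat \<Rightarrow> int \<Rightarrow> 'a::field poly6 set set" where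
  "thickening_piece t d =
    (\<lambda>a. (minors_ideal [^]\<^bsub>ideals_set poly6_ring\<^esub> t) +>\<^bsub>poly6_ring\<^esub> a) ` homogeneous d"

text \<open>The \<open>\<F>\<close>-vector space \<open>H\<^sup>k\<^sub>\<mm>(R / I\<^sup>t)\<^sub>d\<close> for the ideal \<open>\<mm> = (u, v, w, x, y, z)\<close>.\<close>

definition H_thickening ::
    "nat \<Rightarrow> nat \<Rightarrow> int \<Rightarrow> ('a::field, (nat set \<Rightarrow> ('a poly6 set \<times> nat) set) set) module" where
  "H_thickening k t d =
    (let fs = map Var [Iu, Iv, Iw, Ix, Iy, Iz] in
     restrict_scalars Const
       (local_cohomology poly6_ring fs (thickening t) k)
       (local_cohomology_piece poly6_ring fs (thickening t) (thickening_piece t) k d))"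

text \<open>For \<open>t = p\<^sup>e + 1\<close> one has \<open>q = t - 1\<close> and \<open>q2 = 1\<close>, so the general lower bound
  \<open>2 * (q div q2) - 1\<close> for the rank becomes \<open>2 * t - 3\<close>. The source prints \<open>2 * t - 1\<close> for this
  special case, which is a slip: for \<open>t = 2\<close> the rank is exactly 1.\<close>

end

theory Submission
  imports Defs
begin

text \<open>Write \<open>u\<^sub>1, u\<^sub>2, u\<^sub>3\<close> and \<open>x\<^sub>1, x\<^sub>2, x\<^sub>3\<close> for the rows of the matrix and
  \<open>\<Delta>\<^sub>1, \<Delta>\<^sub>2, \<Delta>\<^sub>3\<close> for the generators of \<open>I\<close>. If \<open>0 < i < 2 q\<close> and \<open>q2\<close> divides \<open>i\<close>, the fractions
  \<open>\<plusminus> (x\<^sub>k / u\<^sub>k)\<^sup>i \<Delta>\<^sub>j\<^sup>q / (x\<^sub>l x\<^sub>m)\<^sup>q\<close> with \<open>{j, l, m} = {1, 2, 3}\<close> form a Cech cocycle of \<open>R / I\<^sup>t\<close> of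
  degree 0: by Frobenius the relation \<open>x\<^sub>1 \<Delta>\<^sub>1 + x\<^sub>2 \<Delta>\<^sub>2 + x\<^sub>3 \<Delta>\<^sub>3 = 0\<close> also holds for the \<open>q\<close>-th powers, and
  changing \<open>k\<close> changes \<open>(x\<^sub>k / u\<^sub>k)\<^sup>i\<close> by a multiple of the \<open>q2\<close>-th power of a minor, while
  \<open>q + q2 \<ge> t\<close>. For the independence set \<open>w = z = 0\<close>. Then \<open>I\<^sup>t\<close> becomes \<open>(D\<^sup>t)\<close> with
  \<open>D = u y - v x\<close>, and since \<open>q < t\<close> there is a map \<open>R / I\<^sup>t \<rightarrow> A / D\<^bsup>q+1\<^esup>\<close> with \<open>A = F[u, v, x, y]\<close>.
  The connecting homomorphism to \<open>H\<^sup>4(A)\<close> sends the \<open>i\<close>-th class, up to sign, to the sum of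
  \<open>(v x)\<^sup>a (u y)\<^sup>b / ((u v)\<^sup>i (x y)\<^sup>q)\<close> over \<open>a + b = i - 1\<close>. This sum has a term with negative exponents
  only, and the degree in \<open>u, v\<close> tells different \<open>i\<close> apart.\<close>

section \<open>Modules and dimensions\<close>

text \<open>Each module axiom for \<open>V\<close> is the image under \<open>h\<close> of the same
  axiom for \<open>C\<close>. The lemma serves to pass from cocycles of a fixed degree to cohomology
  classes, where \<open>h\<close> is the coset map.\<close>

lemma module_surjI:
  assumes C: "module K C" and surj: "h ` carrier C = carrier V"
    and add: "\<And>x y. x \<in> carrier C \<Longrightarrow> y \<in> carrier C \<Longrightarrow> h (x \<oplus>\<^bsub>C\<^esub> y) = h x \<oplus>\<^bsub>V\<^esub> h y"
    and smult: "\<And>r x. r \<in> carrier K \<Longrightarrow> x \<in> carrier C \<Longrightarrow> h (r \<odot>\<^bsub>C\<^esub> x) = r \<odot>\<^bsub>V\<^esub> h x"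
    and zero: "h \<zero>\<^bsub>C\<^esub> = \<zero>\<^bsub>V\<^esub>"
  shows "module K V"
proof -
  interpret C: module K C by (rule C)
  have E: "\<exists>x\<in>carrier C. v = h x" if "v \<in> carrier V" for v
    using that surj by auto
  have I: "h x \<in> carrier V" if "x \<in> carrier C" for x
    using that surj by auto
  have neg: "\<exists>y\<in>carrier V. y \<oplus>\<^bsub>V\<^esub> h x = h \<zero>\<^bsub>C\<^esub>" if "x \<in> carrier C" for x
    using that by (intro bexI[of _ "h (\<ominus>\<^bsub>C\<^esub> x)"]) (auto simp: I C.M.l_neg simp flip: add)
  show ?thesis
    by (rule moduleI[OF C.R.is_cring abelian_groupI])
      (auto dest!: E intro!: I neg simp: C.M.a_ac C.smult_l_distr C.smult_r_distr C.smult_assoc1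
        simp flip: add smult zero)
qed

text \<open>Negatives in \<open>S\<close> are obtained by letting minus one in \<open>K\<close> act
  through \<open>\<phi>\<close>, so closure under the scalars yields them.\<close>

lemma restrict_scalars_module:
  assumes C: "module R C" and K: "cring K" and phi: "\<phi> \<in> ring_hom K R"
    and S: "S \<subseteq> carrier C" "\<zero>\<^bsub>C\<^esub> \<in> S" "\<And>x y. x \<in> S \<Longrightarrow> y \<in> S \<Longrightarrow> x \<oplus>\<^bsub>C\<^esub> y \<in> S"
      "\<And>c x. c \<in> carrier K \<Longrightarrow> x \<in> S \<Longrightarrow> \<phi> c \<odot>\<^bsub>C\<^esub> x \<in> S"
  shows "module K (restrict_scalars \<phi> C S)"
proof -
  interpret C: module R C by (rule C)
  interpret K: cring K by (rule K)
  have phi_closed [simp]: "\<phi> c \<in> carrier R" if "c \<in> carrier K" for c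
    using that phi by (rule ring_hom_closed[rotated])
  have SC: "x \<in> carrier C" if "x \<in> S" for x
    using that S(1) by auto
  have neg: "\<exists>y\<in>S. y \<oplus>\<^bsub>C\<^esub> x = \<zero>\<^bsub>C\<^esub>" if "x \<in> S" for x
  proof (intro bexI[of _ "\<phi> (\<ominus>\<^bsub>K\<^esub> \<one>\<^bsub>K\<^esub>) \<odot>\<^bsub>C\<^esub> x"])
    have "\<phi> (\<ominus>\<^bsub>K\<^esub> \<one>\<^bsub>K\<^esub>) \<odot>\<^bsub>C\<^esub> x \<oplus>\<^bsub>C\<^esub> \<phi> \<one>\<^bsub>K\<^esub> \<odot>\<^bsub>C\<^esub> x = \<phi> (\<ominus>\<^bsub>K\<^esub> \<one>\<^bsub>K\<^esub> \<oplus>\<^bsub>K\<^esub> \<one>\<^bsub>K\<^esub>) \<odot>\<^bsub>C\<^esub> x"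
      using that phi by (subst ring_hom_add[OF phi]) (auto simp: C.smult_l_distr SC)
    also have "\<dots> = \<zero>\<^bsub>C\<^esub>"
      using that ring_hom_zero[OF phi K.ring_axioms C.R.ring_axioms] by (simp add: K.l_neg SC)
    finally show "\<phi> (\<ominus>\<^bsub>K\<^esub> \<one>\<^bsub>K\<^esub>) \<odot>\<^bsub>C\<^esub> x \<oplus>\<^bsub>C\<^esub> x = \<zero>\<^bsub>C\<^esub>"
      using that by (simp add: ring_hom_one[OF phi] SC)
  qed (use that S(4) in auto)
  show ?thesis
  proof (rule moduleI[OF K abelian_groupI])
    fix x assume "x \<in> carrier (restrict_scalars \<phi> C S)"
    then show "\<exists>y\<in>carrier (restrict_scalars \<phi> C S). y \<oplus>\<^bsub>restrict_scalars \<phi> C S\<^esub> x = \<zero>\<^bsub>restrict_scalars \<phi> C S\<^esub>"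
      by (simp add: restrict_scalars_def neg)
  qed (auto simp: restrict_scalars_def S(2-4) SC C.M.a_ac C.smult_l_distr C.smult_r_distr
        C.smult_assoc1 ring_hom_add[OF phi] ring_hom_mult[OF phi] ring_hom_one[OF phi])
qed

lemma quotient_module_module:
  assumes "cring R" and J: "ideal J R"
  shows "module R (quotient_module R J)"
proof -
  interpret R: cring R by fact
  interpret J: ideal J R by (rule J)
  interpret Q: cring "R Quot J"
    by (rule J.quotient_is_cring[OF R.is_cring])
  let ?Q = "quotient_module R J"
  have rep: "\<exists>a\<in>carrier R. A = J +>\<^bsub>R\<^esub> a" if "A \<in> carrier ?Q" for A
    using that by (auto simp: quotient_module_def FactRing_def A_RCOSETS_def')
  have closed: "J +>\<^bsub>R\<^esub> a \<in> carrier (R Quot J)" if "a \<in> carrier R" for a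
    using that by (auto simp: FactRing_def A_RCOSETS_def')
  have mult: "(J +>\<^bsub>R\<^esub> a) \<otimes>\<^bsub>R Quot J\<^esub> (J +>\<^bsub>R\<^esub> b) = J +>\<^bsub>R\<^esub> (a \<otimes>\<^bsub>R\<^esub> b)"
    if "a \<in> carrier R" "b \<in> carrier R" for a b
    using that by (simp add: FactRing_def J.rcoset_mult_add)
  have add: "(J +>\<^bsub>R\<^esub> a) \<oplus>\<^bsub>R Quot J\<^esub> (J +>\<^bsub>R\<^esub> b) = J +>\<^bsub>R\<^esub> (a \<oplus>\<^bsub>R\<^esub> b)"
    if "a \<in> carrier R" "b \<in> carrier R" for a b
    using that by (simp add: FactRing_def J.a_rcos_sum)
  show ?thesis
  proof (rule moduleI[OF R.is_cring abelian_groupI])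
    fix A assume "A \<in> carrier ?Q"
    then show "\<exists>B\<in>carrier ?Q. B \<oplus>\<^bsub>?Q\<^esub> A = \<zero>\<^bsub>?Q\<^esub>"
      by (intro bexI[of _ "\<ominus>\<^bsub>R Quot J\<^esub> A"]) (auto simp: quotient_module_def Q.l_neg)
  next
    fix r s A assume r: "r \<in> carrier R" "s \<in> carrier R" and A: "A \<in> carrier ?Q"
    obtain a where "a \<in> carrier R" "A = J +>\<^bsub>R\<^esub> a"
      using rep[OF A] by blast
    with r show "(r \<oplus>\<^bsub>R\<^esub> s) \<odot>\<^bsub>?Q\<^esub> A = r \<odot>\<^bsub>?Q\<^esub> A \<oplus>\<^bsub>?Q\<^esub> s \<odot>\<^bsub>?Q\<^esub> A"
      "(r \<otimes>\<^bsub>R\<^esub> s) \<odot>\<^bsub>?Q\<^esub> A = r \<odot>\<^bsub>?Q\<^esub> (s \<odot>\<^bsub>?Q\<^esub> A)"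
      by (simp_all add: quotient_module_def mult add R.l_distr R.m_assoc)
  next
    fix A assume A: "A \<in> carrier ?Q"
    obtain a where "a \<in> carrier R" "A = J +>\<^bsub>R\<^esub> a"
      using rep[OF A] by blast
    then show "\<one>\<^bsub>R\<^esub> \<odot>\<^bsub>?Q\<^esub> A = A"
      by (simp add: quotient_module_def mult)
  qed (auto simp: quotient_module_def closed Q.a_ac Q.r_distr)
qed

text \<open>A family with only trivial relations is injective and its values form an independent
  set, so the dimension is at least \<open>n\<close>. In the infinite-dimensional case the rank is
  infinite and the bound is immediate.\<close>

lemma vs_rank_geI:
  assumes "vectorspace K V" and v: "\<And>i. i < n \<Longrightarrow> v i \<in> carrier V"
    and indep: "\<And>a i. a \<in> {..<n} \<rightarrow> carrier K \<Longrightarrow> (\<Oplus>\<^bsub>V\<^esub>i\<in>{..<n}. a i \<odot>\<^bsub>V\<^esub> v i) = \<zero>\<^bsub>V\<^esub> \<Longrightarrow> i < n \<Longrightarrow> a i = \<zero>\<^bsub>K\<^esub>"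
  shows "enat n \<le> vs_rank K V"
proof (cases "vectorspace.fin_dim K V")
  case True
  interpret V: vectorspace K V by fact
  have inj: "inj_on v {..<n}"
  proof (rule ccontr)
    assume "\<not> inj_on v {..<n}"
    then obtain i j where ij: "i < n" "j < n" "i \<noteq> j" "v i = v j"
      by (auto simp: inj_on_def)
    \<comment> \<open>If two members coincide, their difference is a relation whose coefficient at
      \<open>i\<close> is one.\<close>
    define a where "a l = (if l = i then \<one>\<^bsub>K\<^esub> else if l = j then \<ominus>\<^bsub>K\<^esub> \<one>\<^bsub>K\<^esub> else \<zero>\<^bsub>K\<^esub>)" for l
    have "(\<Oplus>\<^bsub>V\<^esub>l\<in>{..<n}. a l \<odot>\<^bsub>V\<^esub> v l) = (\<Oplus>\<^bsub>V\<^esub>l\<in>{i, j}. a l \<odot>\<^bsub>V\<^esub> v l)"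
      using ij v by (intro V.M.add.finprod_mono_neutral_cong_right) (auto simp: a_def)
    also have "\<dots> = \<zero>\<^bsub>V\<^esub>"
      using ij v by (simp add: a_def V.M.finsum_insert V.smult_l_minus V.M.r_neg)
    finally have "a i = \<zero>\<^bsub>K\<^esub>"
      using ij by (intro indep) (auto simp: a_def)
    then show False by (simp add: a_def)
  qed
  have "\<not> V.lin_dep (v ` {..<n})"
  proof
    assume "V.lin_dep (v ` {..<n})"
    then obtain A a w where A: "finite A" "A \<subseteq> v ` {..<n}" "a \<in> A \<rightarrow> carrier K"
      "V.lincomb a A = \<zero>\<^bsub>V\<^esub>" "w \<in> A" "a w \<noteq> \<zero>\<^bsub>K\<^esub>"
      unfolding V.lin_dep_def by blast
    define I where "I = {i. i < n \<and> v i \<in> A}"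
    have I: "v ` I = A" "I \<subseteq> {..<n}"
      using A(2) by (auto simp: I_def)
    \<comment> \<open>A relation on the set of values is pulled back to the indices, with zero where
      the value lies outside \<open>A\<close>.\<close>
    define b where "b i = (if i \<in> I then a (v i) else \<zero>\<^bsub>K\<^esub>)" for i
    have aI: "a (v i) \<in> carrier K" if "i \<in> I" for i
      using that A(3) by (auto simp: I_def)
    have av: "a (v i) \<odot>\<^bsub>V\<^esub> v i \<in> carrier V" if "i \<in> I" for i
      using that A(3) v by (auto simp: I_def)
    have "(\<Oplus>\<^bsub>V\<^esub>i\<in>{..<n}. b i \<odot>\<^bsub>V\<^esub> v i) = (\<Oplus>\<^bsub>V\<^esub>i\<in>I. a (v i) \<odot>\<^bsub>V\<^esub> v i)"
      using av v I by (intro V.M.add.finprod_mono_neutral_cong_right) (auto simp: b_def)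
    also have "\<dots> = (\<Oplus>\<^bsub>V\<^esub>w\<in>v ` I. a w \<odot>\<^bsub>V\<^esub> w)"
      using av inj_on_subset[OF inj I(2)] by (intro V.M.finsum_reindex[symmetric]) auto
    also have "\<dots> = \<zero>\<^bsub>V\<^esub>"
      using A(4) I(1) by (simp add: V.lincomb_def)
    finally have b0: "b i = \<zero>\<^bsub>K\<^esub>" if "i < n" for i
      using that aI I(2) by (intro indep) (auto simp: b_def)
    obtain i where "i \<in> I" "w = v i"
      using A(5) I(1) by blast
    then show False
      using A(6) b0[of i] by (auto simp: b_def I_def)
  qed
  then have "card (v ` {..<n}) \<le> V.dim"
    using True v by (intro V.li_le_dim) auto
  then show ?thesis
    using True inj by (simp add: vs_rank_def card_image)
qed (simp add: vs_rank_def)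

section \<open>Localisation as a module\<close>

context module
begin

lemma pow_smult_add:
  assumes "f \<in> carrier R" "x \<in> carrier M"
  shows "(f [^] (i::nat)) \<odot>\<^bsub>M\<^esub> ((f [^] (j::nat)) \<odot>\<^bsub>M\<^esub> x) = (f [^] (i + j)) \<odot>\<^bsub>M\<^esub> x"
  using assms by (simp add: smult_assoc1[symmetric] R.nat_pow_mult)

lemma smult_left_commute:
  assumes "a \<in> carrier R" "b \<in> carrier R" "x \<in> carrier M"
  shows "a \<odot>\<^bsub>M\<^esub> (b \<odot>\<^bsub>M\<^esub> x) = b \<odot>\<^bsub>M\<^esub> (a \<odot>\<^bsub>M\<^esub> x)"
  using assms by (simp add: smult_assoc1[symmetric] R.m_comm)

text \<open>The definition only has the exponents \<open>l + k\<close> and \<open>l + n\<close>. A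
  relation with general exponents \<open>i\<close> and \<open>j\<close> takes this shape, with
  \<open>l = i\<close>, after multiplication by the \<open>k\<close>-th power of
  \<open>f\<close>.\<close>

lemma frac_mem_iff:
  assumes f: "f \<in> carrier R" and a: "a \<in> carrier M"
  shows "(b, k) \<in> frac R M f a n \<longleftrightarrow> b \<in> carrier M \<and>
    (\<exists>i j. i + n = j + k \<and> (f [^] (i::nat)) \<odot>\<^bsub>M\<^esub> a = (f [^] (j::nat)) \<odot>\<^bsub>M\<^esub> b)" (is "_ = (_ \<and> ?P)")
proof -
  have "(\<exists>l::nat. (f [^] (l + k)) \<odot>\<^bsub>M\<^esub> a = (f [^] (l + n)) \<odot>\<^bsub>M\<^esub> b) \<longleftrightarrow> ?P" if b: "b \<in> carrier M"
  proof
    assume "\<exists>l::nat. (f [^] (l + k)) \<odot>\<^bsub>M\<^esub> a = (f [^] (l + n)) \<odot>\<^bsub>M\<^esub> b"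
    then obtain l :: nat where "(f [^] (l + k)) \<odot>\<^bsub>M\<^esub> a = (f [^] (l + n)) \<odot>\<^bsub>M\<^esub> b" ..
    then show ?P by (intro exI[of _ "l + k"] exI[of _ "l + n"]) simp
  next
    assume ?P
    then obtain i j :: nat where ij: "i + n = j + k" "(f [^] i) \<odot>\<^bsub>M\<^esub> a = (f [^] j) \<odot>\<^bsub>M\<^esub> b"
      by blast
    have "(f [^] (i + k)) \<odot>\<^bsub>M\<^esub> a = (f [^] (i + n)) \<odot>\<^bsub>M\<^esub> b"
      using pow_smult_add[OF f a, of k i] pow_smult_add[OF f b, of k j] ij by (simp add: add.commute)
    then show "\<exists>l::nat. (f [^] (l + k)) \<odot>\<^bsub>M\<^esub> a = (f [^] (l + n)) \<odot>\<^bsub>M\<^esub> b" ..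
  qed
  then show ?thesis by (auto simp: frac_def)
qed

text \<open>This is transitivity of equality of fractions: the two relations involving
  \<open>a\<close> are multiplied by powers of \<open>f\<close> until \<open>a\<close> can be
  eliminated.\<close>

lemma frac_subset:
  assumes f: "f \<in> carrier R" and a: "a \<in> carrier M" and b: "b \<in> carrier M"
    and ij: "i + n = j + k" "(f [^] (i::nat)) \<odot>\<^bsub>M\<^esub> a = (f [^] (j::nat)) \<odot>\<^bsub>M\<^esub> b"
  shows "frac R M f a n \<subseteq> frac R M f b k"
proof (rule subrelI)
  fix c m assume "(c, m) \<in> frac R M f a n"
  then obtain i' j' :: nat where c: "c \<in> carrier M" "i' + n = j' + m" "(f [^] i') \<odot>\<^bsub>M\<^esub> a = (f [^] j') \<odot>\<^bsub>M\<^esub> c"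
    by (auto simp: frac_mem_iff f a)
  have "(f [^] (i' + j)) \<odot>\<^bsub>M\<^esub> b = (f [^] (i + j')) \<odot>\<^bsub>M\<^esub> c"
    by (metis add.commute pow_smult_add f a b c(1) ij(2) c(3))
  moreover have "i' + j + k = i + j' + m"
    using ij(1) c(2) by simp
  ultimately show "(c, m) \<in> frac R M f b k"
    using c(1) f b by (auto simp: frac_mem_iff)
qed

lemma frac_eqI:
  assumes "f \<in> carrier R" "a \<in> carrier M" "b \<in> carrier M"
    and "i + n = j + k" "(f [^] (i::nat)) \<odot>\<^bsub>M\<^esub> a = (f [^] (j::nat)) \<odot>\<^bsub>M\<^esub> b"
  shows "frac R M f a n = frac R M f b k"
  using assms by (intro subset_antisym frac_subset[of f a b i n j k] frac_subset[of f b a j k i n]) auto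

lemma frac_self: "f \<in> carrier R \<Longrightarrow> a \<in> carrier M \<Longrightarrow> (a, n) \<in> frac R M f a n"
  by (auto simp: frac_mem_iff)

lemma frac_eq_iff:
  assumes "f \<in> carrier R" "a \<in> carrier M" "b \<in> carrier M"
  shows "frac R M f a n = frac R M f b k \<longleftrightarrow>
    (\<exists>i j. i + n = j + k \<and> (f [^] (i::nat)) \<odot>\<^bsub>M\<^esub> a = (f [^] (j::nat)) \<odot>\<^bsub>M\<^esub> b)"
  using assms frac_self[of f b k] frac_eqI[of f a b] by (metis frac_mem_iff)

lemma frac_expand:
  assumes "f \<in> carrier R" "a \<in> carrier M"
  shows "frac R M f ((f [^] (m::nat)) \<odot>\<^bsub>M\<^esub> a) (n + m) = frac R M f a n"
  using assms by (intro frac_eqI[where i = 0 and j = m]) auto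

text \<open>The operations on fractions are unions over all representatives. If the members of such
  a union do not depend on the representative, it collapses to its value at the given one.\<close>

lemma UN_frac_eqI:
  assumes "f \<in> carrier R" "a \<in> carrier M"
    and "\<And>b k i j. b \<in> carrier M \<Longrightarrow> (i::nat) + n = j + k \<Longrightarrow>
      (f [^] (i::nat)) \<odot>\<^bsub>M\<^esub> a = (f [^] (j::nat)) \<odot>\<^bsub>M\<^esub> b \<Longrightarrow> F a n = F b k"
  shows "(\<Union>(b, k)\<in>frac R M f a n. F b k) = F a n"
proof -
  have "F b k = F a n" if "(b, k) \<in> frac R M f a n" for b k
    using that assms(3) unfolding frac_mem_iff[OF assms(1,2)] by metis
  moreover have "(a, n) \<in> frac R M f a n"
    using assms(1,2) by (rule frac_self)
  ultimately show ?thesis by blast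
qed

lemma localisation_carrier: "carrier (localisation R M f) = {frac R M f a n | a n. a \<in> carrier M}"
  by (simp add: localisation_def)

lemma localisation_zero: "\<zero>\<^bsub>localisation R M f\<^esub> = frac R M f \<zero>\<^bsub>M\<^esub> 0"
  by (simp add: localisation_def)

lemma frac_zero: "f \<in> carrier R \<Longrightarrow> frac R M f \<zero>\<^bsub>M\<^esub> n = \<zero>\<^bsub>localisation R M f\<^esub>"
  unfolding localisation_zero by (intro frac_eqI[where i = 0 and j = n]) auto

lemma localisation_smult:
  assumes f: "f \<in> carrier R" and a: "a \<in> carrier M" and r: "r \<in> carrier R"
  shows "r \<odot>\<^bsub>localisation R M f\<^esub> frac R M f a n = frac R M f (r \<odot>\<^bsub>M\<^esub> a) n"
proof -
  have "frac R M f (r \<odot>\<^bsub>M\<^esub> a) n = frac R M f (r \<odot>\<^bsub>M\<^esub> b) k"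
    if "b \<in> carrier M" "i + n = j + k" "(f [^] i) \<odot>\<^bsub>M\<^esub> a = (f [^] j) \<odot>\<^bsub>M\<^esub> b" for b k and i j :: nat
  proof (rule frac_eqI[OF f _ _ that(2)])
    show "(f [^] i) \<odot>\<^bsub>M\<^esub> (r \<odot>\<^bsub>M\<^esub> a) = (f [^] j) \<odot>\<^bsub>M\<^esub> (r \<odot>\<^bsub>M\<^esub> b)"
      using that f a r by (metis smult_left_commute R.nat_pow_closed)
  qed (use that a r in auto)
  from UN_frac_eqI[OF f a, of n "\<lambda>a n. frac R M f (r \<odot>\<^bsub>M\<^esub> a) n", OF this] show ?thesis
    by (simp add: localisation_def)
qed

lemma localisation_add:
  assumes f: "f \<in> carrier R" and a: "a \<in> carrier M" and b: "b \<in> carrier M"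
  shows "frac R M f a n \<oplus>\<^bsub>localisation R M f\<^esub> frac R M f b k =
    frac R M f ((f [^] k) \<odot>\<^bsub>M\<^esub> a \<oplus>\<^bsub>M\<^esub> (f [^] n) \<odot>\<^bsub>M\<^esub> b) (n + k)"
proof -
  let ?F = "\<lambda>a n b k. frac R M f ((f [^] (k::nat)) \<odot>\<^bsub>M\<^esub> a \<oplus>\<^bsub>M\<^esub> (f [^] (n::nat)) \<odot>\<^bsub>M\<^esub> b) (n + k)"
  \<comment> \<open>Independence of the representative of the second summand. For the first summand
    it follows by commutativity, and then the nested unions collapse one after the other.\<close>
  have 1: "?F a n b k = ?F a n b' k'"
    if "a \<in> carrier M" "b \<in> carrier M" "b' \<in> carrier M" "i + k = j + k'" "(f [^] i) \<odot>\<^bsub>M\<^esub> b = (f [^] j) \<odot>\<^bsub>M\<^esub> b'"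
    for a n b k b' k' and i j :: nat
  proof (rule frac_eqI[OF f])
    have "(f [^] i) \<odot>\<^bsub>M\<^esub> ((f [^] n) \<odot>\<^bsub>M\<^esub> b) = (f [^] j) \<odot>\<^bsub>M\<^esub> ((f [^] n) \<odot>\<^bsub>M\<^esub> b')"
      using that f by (metis smult_left_commute R.nat_pow_closed)
    then show "(f [^] i) \<odot>\<^bsub>M\<^esub> ((f [^] k) \<odot>\<^bsub>M\<^esub> a \<oplus>\<^bsub>M\<^esub> (f [^] n) \<odot>\<^bsub>M\<^esub> b) =
      (f [^] j) \<odot>\<^bsub>M\<^esub> ((f [^] k') \<odot>\<^bsub>M\<^esub> a \<oplus>\<^bsub>M\<^esub> (f [^] n) \<odot>\<^bsub>M\<^esub> b')"
      using that f by (simp add: smult_r_distr pow_smult_add)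
  qed (use that f in auto)
  have comm: "?F a n b k = ?F b k a n" if "a \<in> carrier M" "b \<in> carrier M" for a n b k
    using that f by (simp add: M.a_comm add.commute)
  have 2: "?F a n b k = ?F a' n' b k"
    if "a \<in> carrier M" "b \<in> carrier M" "a' \<in> carrier M" "i + n = j + n'" "(f [^] i) \<odot>\<^bsub>M\<^esub> a = (f [^] j) \<odot>\<^bsub>M\<^esub> a'"
    for a n b k a' n' and i j :: nat
    using 1[OF that(2,1,3,4,5)] comm that by metis
  have "(\<Union>(a, n)\<in>frac R M f a n. \<Union>(b, k)\<in>frac R M f b k. ?F a n b k) = (\<Union>(b, k)\<in>frac R M f b k. ?F a n b k)"
  proof (rule UN_frac_eqI[OF f a])
    fix a' n' and i j :: nat
    assume that: "a' \<in> carrier M" "i + n = j + n'" "(f [^] i) \<odot>\<^bsub>M\<^esub> a = (f [^] j) \<odot>\<^bsub>M\<^esub> a'"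
    show "(\<Union>(b, k)\<in>frac R M f b k. ?F a n b k) = (\<Union>(b, k)\<in>frac R M f b k. ?F a' n' b k)"
      using 2[OF a _ that] by (intro SUP_cong refl) (metis (no_types, lifting) b case_prod_conv f frac_mem_iff surj_pair)
  qed
  also have "\<dots> = ?F a n b k"
    using 1[OF a b] by (intro UN_frac_eqI[OF f b]) auto
  finally show ?thesis
    by (simp add: localisation_def)
qed

lemma localisation_add_same:
  assumes f: "f \<in> carrier R" and a: "a \<in> carrier M" and b: "b \<in> carrier M"
  shows "frac R M f a n \<oplus>\<^bsub>localisation R M f\<^esub> frac R M f b n = frac R M f (a \<oplus>\<^bsub>M\<^esub> b) n"
  using assms by (simp add: localisation_add smult_r_distr[symmetric] frac_expand)

lemma common_denominator:
  assumes f: "f \<in> carrier R" and "A \<in> carrier (localisation R M f)" "B \<in> carrier (localisation R M f)"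
  obtains a b n where "a \<in> carrier M" "b \<in> carrier M" "A = frac R M f a n" "B = frac R M f b n"
proof -
  from assms obtain a n b k where a: "a \<in> carrier M" "A = frac R M f a n"
    and b: "b \<in> carrier M" "B = frac R M f b k"
    by (auto simp: localisation_carrier)
  have "A = frac R M f ((f [^] k) \<odot>\<^bsub>M\<^esub> a) (n + k)" "B = frac R M f ((f [^] n) \<odot>\<^bsub>M\<^esub> b) (n + k)"
    using a b f frac_expand[of f a k n] frac_expand[of f b n k] by (simp_all add: add.commute)
  with a b f show ?thesis
    by (intro that[of "(f [^] k) \<odot>\<^bsub>M\<^esub> a" "(f [^] n) \<odot>\<^bsub>M\<^esub> b" "n + k"]) auto
qed

lemma frac_closed: "a \<in> carrier M \<Longrightarrow> frac R M f a n \<in> carrier (localisation R M f)"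
  by (auto simp: localisation_carrier)

lemma localisation_module:
  assumes f: "f \<in> carrier R"
  shows "module R (localisation R M f)"
proof -
  let ?L = "localisation R M f"
  have add_closed: "A \<oplus>\<^bsub>?L\<^esub> B \<in> carrier ?L" if "A \<in> carrier ?L" "B \<in> carrier ?L" for A B
    using f by (rule common_denominator[OF _ that]) (auto simp: localisation_add_same f frac_closed)
  have elim: "\<exists>a n. a \<in> carrier M \<and> A = frac R M f a n" if "A \<in> carrier ?L" for A
    using that by (auto simp: localisation_carrier)
  have smult_closed: "r \<odot>\<^bsub>?L\<^esub> A \<in> carrier ?L" if "r \<in> carrier R" "A \<in> carrier ?L" for r A
    using that(1) elim[OF that(2)] f by (auto simp: localisation_smult intro!: frac_closed)
  show ?thesis
  proof (rule moduleI[OF R.is_cring abelian_groupI])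
    fix A B C assume A: "A \<in> carrier ?L" and B: "B \<in> carrier ?L" and C: "C \<in> carrier ?L"
    obtain a n where a: "a \<in> carrier M" "A = frac R M f a n"
      using elim[OF A] by blast
    obtain b k where b: "b \<in> carrier M" "B = frac R M f b k"
      using elim[OF B] by blast
    obtain c m where c: "c \<in> carrier M" "C = frac R M f c m"
      using elim[OF C] by blast
    show "(A \<oplus>\<^bsub>?L\<^esub> B) \<oplus>\<^bsub>?L\<^esub> C = A \<oplus>\<^bsub>?L\<^esub> (B \<oplus>\<^bsub>?L\<^esub> C)"
      using a b c f by (simp add: localisation_add smult_r_distr pow_smult_add M.a_assoc add.commute add.left_commute)
  next
    fix A B assume "A \<in> carrier ?L" "B \<in> carrier ?L"
    then obtain a b n where "a \<in> carrier M" "b \<in> carrier M" "A = frac R M f a n" "B = frac R M f b n"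
      by (rule common_denominator[OF f])
    then show "A \<oplus>\<^bsub>?L\<^esub> B = B \<oplus>\<^bsub>?L\<^esub> A"
      by (auto simp: localisation_add_same f M.a_comm)
  next
    fix A assume "A \<in> carrier ?L"
    then obtain a n where a: "a \<in> carrier M" "A = frac R M f a n"
      using elim by blast
    then show "\<zero>\<^bsub>?L\<^esub> \<oplus>\<^bsub>?L\<^esub> A = A"
      using f by (simp add: localisation_add_same frac_zero[OF f, of n, symmetric])
  next
    fix A assume "A \<in> carrier ?L"
    then obtain a n where "a \<in> carrier M" "A = frac R M f a n"
      using elim by blast
    then show "\<exists>B\<in>carrier ?L. B \<oplus>\<^bsub>?L\<^esub> A = \<zero>\<^bsub>?L\<^esub>"
      using f by (intro bexI[of _ "frac R M f (\<ominus>\<^bsub>M\<^esub> a) n"])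
        (auto simp: localisation_add_same frac_closed M.l_neg frac_zero)
  next
    fix r A B assume r: "r \<in> carrier R" and "A \<in> carrier ?L" "B \<in> carrier ?L"
    from this(2,3) obtain a b n where "a \<in> carrier M" "b \<in> carrier M" "A = frac R M f a n" "B = frac R M f b n"
      by (rule common_denominator[OF f])
    then show "r \<odot>\<^bsub>?L\<^esub> (A \<oplus>\<^bsub>?L\<^esub> B) = r \<odot>\<^bsub>?L\<^esub> A \<oplus>\<^bsub>?L\<^esub> r \<odot>\<^bsub>?L\<^esub> B"
      using r by (auto simp: localisation_add_same localisation_smult f smult_r_distr)
  qed (use add_closed smult_closed f in \<open>auto simp: localisation_carrier localisation_add_same localisation_smult
      smult_l_distr smult_assoc1 localisation_zero\<close>)
qed

lemma localisation_map_frac: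
  assumes g: "g \<in> carrier R" and h: "h \<in> carrier R" and a: "a \<in> carrier M"
  shows "localisation_map R M g h (frac R M g a n) = frac R M (g \<otimes> h) ((h [^] n) \<odot>\<^bsub>M\<^esub> a) n"
proof -
  have "frac R M (g \<otimes> h) ((h [^] n) \<odot>\<^bsub>M\<^esub> a) n = frac R M (g \<otimes> h) ((h [^] k) \<odot>\<^bsub>M\<^esub> b) k"
    if b: "b \<in> carrier M" and ij: "i + n = j + k" and "(g [^] i) \<odot>\<^bsub>M\<^esub> a = (g [^] j) \<odot>\<^bsub>M\<^esub> b"
    for b k and i j :: nat
  proof (rule frac_eqI[OF _ _ _ ij])
    \<comment> \<open>The right-hand side depends only on \<open>i + n\<close> and on the product of
      \<open>g\<close> to the \<open>i\<close> with \<open>a\<close>. Both agree for two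
      representatives of the same fraction.\<close>
    have *: "((g \<otimes> h) [^] i) \<odot>\<^bsub>M\<^esub> ((h [^] n) \<odot>\<^bsub>M\<^esub> a) = (h [^] (i + n)) \<odot>\<^bsub>M\<^esub> ((g [^] i) \<odot>\<^bsub>M\<^esub> a)"
      if "a \<in> carrier M" for a and i n :: nat
      using g h that
      by (simp add: R.nat_pow_distrib smult_assoc1 pow_smult_add smult_left_commute[of "h [^] (i + n)"])
    show "((g \<otimes> h) [^] i) \<odot>\<^bsub>M\<^esub> ((h [^] n) \<odot>\<^bsub>M\<^esub> a) = ((g \<otimes> h) [^] j) \<odot>\<^bsub>M\<^esub> ((h [^] k) \<odot>\<^bsub>M\<^esub> b)"
      using that a b by (simp add: *)
  qed (use g h a b in auto)
  from UN_frac_eqI[OF g a, of n "\<lambda>a n. frac R M (g \<otimes> h) ((h [^] n) \<odot>\<^bsub>M\<^esub> a) n", OF this]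
  show ?thesis by (simp add: localisation_map_def)
qed

lemma frac_finsum:
  assumes f: "f \<in> carrier R" and "finite S" and "a \<in> S \<rightarrow> carrier M"
  shows "(\<Oplus>\<^bsub>localisation R M f\<^esub>i\<in>S. frac R M f (a i) n) = frac R M f (\<Oplus>\<^bsub>M\<^esub>i\<in>S. a i) n"
  using assms(2,3)
proof (induction S)
  case empty
  then show ?case
    using abelian_group.axioms(1)[OF module.axioms(2)[OF localisation_module[OF f]]]
    by (simp add: abelian_monoid.finsum_empty M.finsum_empty frac_zero[OF f])
next
  case (insert i S)
  interpret L: module R "localisation R M f"
    by (rule localisation_module[OF f])
  have "(\<lambda>i. frac R M f (a i) n) \<in> insert i S \<rightarrow> carrier (localisation R M f)"
    using insert.prems by (auto intro!: frac_closed)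
  with insert show ?case
    by (simp add: L.finsum_insert M.finsum_insert Pi_iff localisation_add_same[OF f])
qed

lemma localisation_map_closed:
  assumes "g \<in> carrier R" "h \<in> carrier R" "A \<in> carrier (localisation R M g)"
  shows "localisation_map R M g h A \<in> carrier (localisation R M (g \<otimes> h))"
  using assms by (auto simp: localisation_carrier[of g] localisation_map_frac intro!: frac_closed)

lemma localisation_map_add:
  assumes g: "g \<in> carrier R" and h: "h \<in> carrier R"
    and "A \<in> carrier (localisation R M g)" "B \<in> carrier (localisation R M g)"
  shows "localisation_map R M g h (A \<oplus>\<^bsub>localisation R M g\<^esub> B) =
    localisation_map R M g h A \<oplus>\<^bsub>localisation R M (g \<otimes> h)\<^esub> localisation_map R M g h B"
proof -
  from assms(3,4) obtain a b n where "a \<in> carrier M" "b \<in> carrier M" "A = frac R M g a n" "B = frac R M g b n"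
    by (rule common_denominator[OF g])
  then show ?thesis
    using g h by (simp add: localisation_add_same localisation_map_frac smult_r_distr)
qed

lemma localisation_map_smult:
  assumes "g \<in> carrier R" "h \<in> carrier R" "r \<in> carrier R" "A \<in> carrier (localisation R M g)"
  shows "localisation_map R M g h (r \<odot>\<^bsub>localisation R M g\<^esub> A) =
    r \<odot>\<^bsub>localisation R M (g \<otimes> h)\<^esub> localisation_map R M g h A"
  using assms by (auto simp: localisation_carrier[of g] localisation_map_frac localisation_smult
      smult_left_commute[of r])

end

section \<open>The Cech complex\<close>

locale cech_complex = module R M for R (structure) and M (structure) +
  fixes fs
  assumes fs: "set fs \<subseteq> carrier R"
begin

lemma cech_index_finite: "S \<in> cech_index fs k \<Longrightarrow> finite S"
  by (auto simp: cech_index_def intro: finite_subset)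

lemma cech_index_nth: "S \<in> cech_index fs k \<Longrightarrow> i \<in> S \<Longrightarrow> fs ! i \<in> carrier R"
  using fs nth_mem[of i fs] by (auto simp: cech_index_def subset_iff)

lemma cech_index_remove: "T \<in> cech_index fs (Suc k) \<Longrightarrow> i \<in> T \<Longrightarrow> T - {i} \<in> cech_index fs k"
  by (auto simp: cech_index_def)

lemma cech_prod_closed: "S \<in> cech_index fs k \<Longrightarrow> cech_prod R fs S \<in> carrier R"
  by (auto simp: cech_prod_def intro!: R.finprod_closed cech_index_nth)

text \<open>This identifies the target of the localisation map from the component at
  \<open>T - {i}\<close> with the component at \<open>T\<close>.\<close>

lemma cech_prod_remove:
  assumes "T \<in> cech_index fs (Suc k)" "i \<in> T"
  shows "cech_prod R fs (T - {i}) \<otimes> fs ! i = cech_prod R fs T"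
proof -
  have "cech_prod R fs (insert i (T - {i})) = fs ! i \<otimes> cech_prod R fs (T - {i})"
    unfolding cech_prod_def using assms cech_index_finite[OF assms(1)]
    by (intro R.finprod_insert) (auto intro!: cech_index_nth)
  then show ?thesis
    using assms cech_prod_closed[OF cech_index_remove[OF assms]] cech_index_nth[OF assms]
    by (simp add: insert_absorb R.m_comm)
qed

lemma cech_loc_module: "S \<in> cech_index fs k \<Longrightarrow> module R (cech_loc R fs M S)"
  unfolding cech_loc_def by (intro localisation_module cech_prod_closed)

lemma cech_loc_abelian_group: "S \<in> cech_index fs k \<Longrightarrow> abelian_group (cech_loc R fs M S)"
  by (rule module.axioms(2)[OF cech_loc_module])

lemma cech_eqI:
  assumes "c \<in> carrier (cech R fs M k)" "c' \<in> carrier (cech R fs M k)"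
    and "\<And>S. S \<in> cech_index fs k \<Longrightarrow> c S = c' S"
  shows "c = c'"
  using assms PiE_ext[of c "cech_index fs k" "\<lambda>S. carrier (cech_loc R fs M S)" c'] by (simp add: cech_def)

lemma cech_component:
  "c \<in> carrier (cech R fs M k) \<Longrightarrow> S \<in> cech_index fs k \<Longrightarrow> c S \<in> carrier (cech_loc R fs M S)"
  by (simp add: cech_def PiE_iff)

lemma cech_zero_component: "S \<in> cech_index fs k \<Longrightarrow> \<zero>\<^bsub>cech R fs M k\<^esub> S = \<zero>\<^bsub>cech_loc R fs M S\<^esub>"
  by (simp add: cech_def)

lemma cech_add_component:
  "S \<in> cech_index fs k \<Longrightarrow> (c \<oplus>\<^bsub>cech R fs M k\<^esub> c') S = c S \<oplus>\<^bsub>cech_loc R fs M S\<^esub> c' S"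
  by (simp add: cech_def)

lemma cech_smult_component:
  "S \<in> cech_index fs k \<Longrightarrow> (r \<odot>\<^bsub>cech R fs M k\<^esub> c) S = r \<odot>\<^bsub>cech_loc R fs M S\<^esub> c S"
  by (simp add: cech_def)

lemma cech_module: "module R (cech R fs M k)"
proof -
  let ?C = "cech R fs M k"
  note ab = abelian_groupE[OF cech_loc_abelian_group]
  note comp = cech_component cech_zero_component cech_add_component cech_smult_component
  have add_closed: "c \<oplus>\<^bsub>?C\<^esub> c' \<in> carrier ?C" if "c \<in> carrier ?C" "c' \<in> carrier ?C" for c c'
    using that by (auto simp: cech_def intro!: ab(1))
  have zero_closed: "\<zero>\<^bsub>?C\<^esub> \<in> carrier ?C"
    by (auto simp: cech_def intro!: ab(2))
  have smult_closed: "r \<odot>\<^bsub>?C\<^esub> c \<in> carrier ?C" if "r \<in> carrier R" "c \<in> carrier ?C" for r c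
    using that by (auto simp: cech_def intro!: module.smult_closed[OF cech_loc_module])
  note closed = add_closed zero_closed smult_closed
  show ?thesis
  proof (rule moduleI[OF R.is_cring abelian_groupI])
    fix c assume c: "c \<in> carrier ?C"
    let ?n = "\<lambda>S\<in>cech_index fs k. \<ominus>\<^bsub>cech_loc R fs M S\<^esub> c S"
    have n: "?n \<in> carrier ?C"
      using c by (auto simp: cech_def intro!: abelian_group.a_inv_closed[OF cech_loc_abelian_group])
    have "?n \<oplus>\<^bsub>?C\<^esub> c = \<zero>\<^bsub>?C\<^esub>"
      using c n closed
      by (intro cech_eqI) (auto simp: comp abelian_group.l_neg[OF cech_loc_abelian_group])
    with n show "\<exists>c'\<in>carrier ?C. c' \<oplus>\<^bsub>?C\<^esub> c = \<zero>\<^bsub>?C\<^esub>" by blast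
  next
    fix c c' assume "c \<in> carrier ?C" "c' \<in> carrier ?C"
    then show "c \<oplus>\<^bsub>?C\<^esub> c' = c' \<oplus>\<^bsub>?C\<^esub> c"
      by (intro cech_eqI[where k = k]) (simp_all add: closed comp ab(4))
  qed (auto intro!: closed cech_eqI simp: comp ab(3,5)
      module.smult_l_distr[OF cech_loc_module] module.smult_r_distr[OF cech_loc_module]
      module.smult_assoc1[OF cech_loc_module] module.smult_one[OF cech_loc_module])
qed

abbreviation face :: "nat set \<Rightarrow> nat \<Rightarrow> ('c \<times> nat) set \<Rightarrow> ('c \<times> nat) set" where
  "face T i \<equiv> localisation_map R M (cech_prod R fs (T - {i})) (fs ! i)"

lemma face_closed:
  assumes "T \<in> cech_index fs (Suc k)" "i \<in> T" "A \<in> carrier (cech_loc R fs M (T - {i}))"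
  shows "face T i A \<in> carrier (cech_loc R fs M T)"
  using assms localisation_map_closed[OF cech_prod_closed[OF cech_index_remove[OF assms(1,2)]]
      cech_index_nth[OF assms(1,2)]]
  by (simp add: cech_loc_def cech_prod_remove[OF assms(1,2)])

lemma face_add:
  assumes "T \<in> cech_index fs (Suc k)" "i \<in> T"
    "A \<in> carrier (cech_loc R fs M (T - {i}))" "B \<in> carrier (cech_loc R fs M (T - {i}))"
  shows "face T i (A \<oplus>\<^bsub>cech_loc R fs M (T - {i})\<^esub> B) = face T i A \<oplus>\<^bsub>cech_loc R fs M T\<^esub> face T i B"
  using assms localisation_map_add[OF cech_prod_closed[OF cech_index_remove[OF assms(1,2)]]
      cech_index_nth[OF assms(1,2)]]
  by (simp add: cech_loc_def cech_prod_remove[OF assms(1,2)])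

lemma face_smult:
  assumes "T \<in> cech_index fs (Suc k)" "i \<in> T" "r \<in> carrier R" "A \<in> carrier (cech_loc R fs M (T - {i}))"
  shows "face T i (r \<odot>\<^bsub>cech_loc R fs M (T - {i})\<^esub> A) = r \<odot>\<^bsub>cech_loc R fs M T\<^esub> face T i A"
  using assms localisation_map_smult[OF cech_prod_closed[OF cech_index_remove[OF assms(1,2)]]
      cech_index_nth[OF assms(1,2)]]
  by (simp add: cech_loc_def cech_prod_remove[OF assms(1,2)])

abbreviation cech_sign :: "nat set \<Rightarrow> nat \<Rightarrow> 'a" where
  "cech_sign T i \<equiv> (\<ominus> \<one>) [^] card {j \<in> T. j < i}"

lemma cech_diff_component:
  "T \<in> cech_index fs (Suc k) \<Longrightarrow> cech_diff R fs M k c T =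
    (\<Oplus>\<^bsub>cech_loc R fs M T\<^esub>i\<in>T. cech_sign T i \<odot>\<^bsub>cech_loc R fs M T\<^esub> face T i (c (T - {i})))"
  by (simp add: cech_diff_def)

lemma cech_diff_summand_closed:
  assumes "T \<in> cech_index fs (Suc k)" "c \<in> carrier (cech R fs M k)"
  shows "(\<lambda>i. cech_sign T i \<odot>\<^bsub>cech_loc R fs M T\<^esub> face T i (c (T - {i}))) \<in> T \<rightarrow> carrier (cech_loc R fs M T)"
proof
  fix i assume i: "i \<in> T"
  have "c (T - {i}) \<in> carrier (cech_loc R fs M (T - {i}))"
    using assms(2) cech_index_remove[OF assms(1) i] by (rule cech_component)
  then show "cech_sign T i \<odot>\<^bsub>cech_loc R fs M T\<^esub> face T i (c (T - {i})) \<in> carrier (cech_loc R fs M T)"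
    by (simp add: module.smult_closed[OF cech_loc_module[OF assms(1)]] face_closed[OF assms(1) i])
qed

lemma cech_diff_closed:
  assumes "c \<in> carrier (cech R fs M k)"
  shows "cech_diff R fs M k c \<in> carrier (cech R fs M (Suc k))"
proof -
  have "cech_diff R fs M k c T \<in> carrier (cech_loc R fs M T)" if "T \<in> cech_index fs (Suc k)" for T
    using that assms abelian_group.axioms(1)[OF cech_loc_abelian_group[OF that]]
    by (simp add: cech_diff_component abelian_monoid.finsum_closed cech_diff_summand_closed)
  then show ?thesis
    by (auto simp: cech_def cech_diff_def)
qed

lemma cech_diff_add:
  assumes c: "c \<in> carrier (cech R fs M k)" "c' \<in> carrier (cech R fs M k)"
  shows "cech_diff R fs M k (c \<oplus>\<^bsub>cech R fs M k\<^esub> c') =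
    cech_diff R fs M k c \<oplus>\<^bsub>cech R fs M (Suc k)\<^esub> cech_diff R fs M k c'"
proof (rule cech_eqI[where k = "Suc k"])
  interpret C: module R "cech R fs M k" by (rule cech_module)
  interpret D: module R "cech R fs M (Suc k)" by (rule cech_module)
  show "cech_diff R fs M k (c \<oplus>\<^bsub>cech R fs M k\<^esub> c') \<in> carrier (cech R fs M (Suc k))"
    "cech_diff R fs M k c \<oplus>\<^bsub>cech R fs M (Suc k)\<^esub> cech_diff R fs M k c' \<in> carrier (cech R fs M (Suc k))"
    using c by (auto intro!: cech_diff_closed)
  fix T assume T: "T \<in> cech_index fs (Suc k)"
  interpret L: module R "cech_loc R fs M T" by (rule cech_loc_module[OF T])
  have "cech_sign T i \<odot>\<^bsub>cech_loc R fs M T\<^esub> face T i ((c \<oplus>\<^bsub>cech R fs M k\<^esub> c') (T - {i})) =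
      cech_sign T i \<odot>\<^bsub>cech_loc R fs M T\<^esub> face T i (c (T - {i})) \<oplus>\<^bsub>cech_loc R fs M T\<^esub>
      cech_sign T i \<odot>\<^bsub>cech_loc R fs M T\<^esub> face T i (c' (T - {i}))" if i: "i \<in> T" for i
    using c T i cech_index_remove[OF T i]
    by (simp add: cech_add_component face_add cech_component L.smult_r_distr face_closed)
  then have "cech_diff R fs M k (c \<oplus>\<^bsub>cech R fs M k\<^esub> c') T = (\<Oplus>\<^bsub>cech_loc R fs M T\<^esub>i\<in>T.
      cech_sign T i \<odot>\<^bsub>cech_loc R fs M T\<^esub> face T i (c (T - {i})) \<oplus>\<^bsub>cech_loc R fs M T\<^esub>
      cech_sign T i \<odot>\<^bsub>cech_loc R fs M T\<^esub> face T i (c' (T - {i})))"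
    unfolding cech_diff_component[OF T]
    using cech_diff_summand_closed[OF T c(1)] cech_diff_summand_closed[OF T c(2)]
    by (intro L.finsum_cong') auto
  then show "cech_diff R fs M k (c \<oplus>\<^bsub>cech R fs M k\<^esub> c') T =
      (cech_diff R fs M k c \<oplus>\<^bsub>cech R fs M (Suc k)\<^esub> cech_diff R fs M k c') T"
    using T c cech_diff_summand_closed[OF T]
    by (simp add: cech_diff_component cech_add_component L.finsum_addf c)
qed

lemma cech_diff_smult:
  assumes c: "c \<in> carrier (cech R fs M k)" and r: "r \<in> carrier R"
  shows "cech_diff R fs M k (r \<odot>\<^bsub>cech R fs M k\<^esub> c) = r \<odot>\<^bsub>cech R fs M (Suc k)\<^esub> cech_diff R fs M k c"
proof (rule cech_eqI[where k = "Suc k"])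
  interpret C: module R "cech R fs M k" by (rule cech_module)
  interpret D: module R "cech R fs M (Suc k)" by (rule cech_module)
  show "cech_diff R fs M k (r \<odot>\<^bsub>cech R fs M k\<^esub> c) \<in> carrier (cech R fs M (Suc k))"
    "r \<odot>\<^bsub>cech R fs M (Suc k)\<^esub> cech_diff R fs M k c \<in> carrier (cech R fs M (Suc k))"
    using c r by (auto intro!: cech_diff_closed)
  fix T assume T: "T \<in> cech_index fs (Suc k)"
  interpret L: module R "cech_loc R fs M T" by (rule cech_loc_module[OF T])
  have "cech_sign T i \<odot>\<^bsub>cech_loc R fs M T\<^esub> face T i ((r \<odot>\<^bsub>cech R fs M k\<^esub> c) (T - {i})) =
      r \<odot>\<^bsub>cech_loc R fs M T\<^esub> (cech_sign T i \<odot>\<^bsub>cech_loc R fs M T\<^esub> face T i (c (T - {i})))"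
    if i: "i \<in> T" for i
    using c r T i cech_index_remove[OF T i]
    by (simp add: cech_smult_component face_smult cech_component face_closed L.smult_left_commute[of r])
  then have "cech_diff R fs M k (r \<odot>\<^bsub>cech R fs M k\<^esub> c) T = (\<Oplus>\<^bsub>cech_loc R fs M T\<^esub>i\<in>T.
      r \<odot>\<^bsub>cech_loc R fs M T\<^esub> (cech_sign T i \<odot>\<^bsub>cech_loc R fs M T\<^esub> face T i (c (T - {i}))))"
    unfolding cech_diff_component[OF T]
    using cech_diff_summand_closed[OF T c] r
    by (intro L.finsum_cong') auto
  then show "cech_diff R fs M k (r \<odot>\<^bsub>cech R fs M k\<^esub> c) T =
      (r \<odot>\<^bsub>cech R fs M (Suc k)\<^esub> cech_diff R fs M k c) T"
    using T c r cech_diff_summand_closed[OF T] cech_index_finite[OF T]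
    by (simp add: cech_diff_component cech_smult_component L.finsum_smult_ldistr)
qed

lemma cech_diff_zero: "cech_diff R fs M k \<zero>\<^bsub>cech R fs M k\<^esub> = \<zero>\<^bsub>cech R fs M (Suc k)\<^esub>"
proof -
  interpret C: module R "cech R fs M k" by (rule cech_module)
  interpret D: module R "cech R fs M (Suc k)" by (rule cech_module)
  show ?thesis
    using cech_diff_smult[of "\<zero>\<^bsub>cech R fs M k\<^esub>" k \<zero>] cech_diff_closed[of "\<zero>\<^bsub>cech R fs M k\<^esub>" k]
    by simp
qed

text \<open>Over a common exponent \<open>n\<close>, the face map for \<open>i\<close> multiplies
  the numerator by the \<open>n\<close>-th power of \<open>fs ! i\<close>. Hence the differential
  can be computed on numerators alone.\<close>

lemma cech_diff_frac:
  assumes T: "T \<in> cech_index fs (Suc k)" and A: "\<And>S. S \<in> cech_index fs k \<Longrightarrow> A S \<in> carrier M"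
    and c: "\<And>S. S \<in> cech_index fs k \<Longrightarrow> c S = frac R M (cech_prod R fs S) (A S) n"
  shows "cech_diff R fs M k c T = frac R M (cech_prod R fs T)
    (\<Oplus>\<^bsub>M\<^esub>i\<in>T. cech_sign T i \<odot>\<^bsub>M\<^esub> (((fs ! i) [^] n) \<odot>\<^bsub>M\<^esub> A (T - {i}))) n"
proof -
  interpret L: module R "cech_loc R fs M T" by (rule cech_loc_module[OF T])
  have eq: "cech_sign T i \<odot>\<^bsub>cech_loc R fs M T\<^esub> face T i (c (T - {i})) =
      frac R M (cech_prod R fs T) (cech_sign T i \<odot>\<^bsub>M\<^esub> (((fs ! i) [^] n) \<odot>\<^bsub>M\<^esub> A (T - {i}))) n"
    if i: "i \<in> T" for i
    using A[OF cech_index_remove[OF T i]] cech_index_nth[OF T i]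
      cech_prod_closed[OF cech_index_remove[OF T i]] cech_prod_closed[OF T]
    by (simp add: c[OF cech_index_remove[OF T i]] localisation_map_frac cech_prod_remove[OF T i]
        cech_loc_def localisation_smult)
  have closed: "(\<lambda>i. cech_sign T i \<odot>\<^bsub>M\<^esub> (((fs ! i) [^] n) \<odot>\<^bsub>M\<^esub> A (T - {i}))) \<in> T \<rightarrow> carrier M"
    using A cech_index_remove[OF T] cech_index_nth[OF T] by auto
  have "cech_diff R fs M k c T = (\<Oplus>\<^bsub>cech_loc R fs M T\<^esub>i\<in>T.
      frac R M (cech_prod R fs T) (cech_sign T i \<odot>\<^bsub>M\<^esub> (((fs ! i) [^] n) \<odot>\<^bsub>M\<^esub> A (T - {i}))) n)"
    unfolding cech_diff_component[OF T]
    using closed by (intro L.finsum_cong' eq) (auto simp: cech_loc_def intro!: frac_closed)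
  also have "\<dots> = frac R M (cech_prod R fs T)
    (\<Oplus>\<^bsub>M\<^esub>i\<in>T. cech_sign T i \<odot>\<^bsub>M\<^esub> (((fs ! i) [^] n) \<odot>\<^bsub>M\<^esub> A (T - {i}))) n"
    unfolding cech_loc_def
    by (intro frac_finsum cech_prod_closed[OF T] cech_index_finite[OF T] closed)
  finally show ?thesis .
qed

text \<open>There are finitely many components, so the sum of their exponents can serve as a common
  exponent.\<close>

lemma cech_common_denominator:
  assumes c: "c \<in> carrier (cech R fs M k)"
  shows "\<exists>a n. \<forall>S\<in>cech_index fs k. a S \<in> carrier M \<and> c S = frac R M (cech_prod R fs S) (a S) n"
proof -
  have "\<exists>a n. a \<in> carrier M \<and> c S = frac R M (cech_prod R fs S) a n" if "S \<in> cech_index fs k" for S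
    using cech_component[OF c that] by (auto simp: cech_loc_def localisation_carrier)
  then obtain b m where b: "\<And>S. S \<in> cech_index fs k \<Longrightarrow> b S \<in> carrier M"
    and c_eq: "\<And>S. S \<in> cech_index fs k \<Longrightarrow> c S = frac R M (cech_prod R fs S) (b S) (m S)"
    by metis
  have fin: "finite (cech_index fs k)"
    by (rule finite_subset[of _ "Pow {..<length fs}"]) (auto simp: cech_index_def)
  define n where "n = sum m (cech_index fs k)"
  show ?thesis
  proof (intro exI ballI conjI)
    fix S assume S: "S \<in> cech_index fs k"
    then have "m S \<le> n"
      unfolding n_def using fin by (intro member_le_sum) auto
    then show "c S = frac R M (cech_prod R fs S) ((cech_prod R fs S [^] (n - m S)) \<odot>\<^bsub>M\<^esub> b S) n"
      using frac_expand[OF cech_prod_closed[OF S] b[OF S], of "n - m S" "m S"] c_eq[OF S] by simp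
    show "(cech_prod R fs S [^] (n - m S)) \<odot>\<^bsub>M\<^esub> b S \<in> carrier M"
      using cech_prod_closed[OF S] b[OF S] by simp
  qed
qed

section \<open>Cocycles, coboundaries and cohomology classes\<close>

lemma cech_cocycles_smult:
  assumes "c \<in> cech_cocycles R fs M k" "r \<in> carrier R"
  shows "r \<odot>\<^bsub>cech R fs M k\<^esub> c \<in> cech_cocycles R fs M k"
proof -
  interpret C: module R "cech R fs M k" by (rule cech_module)
  interpret D: module R "cech R fs M (Suc k)" by (rule cech_module)
  show ?thesis
    using assms by (auto simp: cech_cocycles_def cech_diff_smult)
qed

lemma cech_cocycles_add:
  assumes "c \<in> cech_cocycles R fs M k" "c' \<in> cech_cocycles R fs M k"
  shows "c \<oplus>\<^bsub>cech R fs M k\<^esub> c' \<in> cech_cocycles R fs M k"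
proof -
  interpret C: module R "cech R fs M k" by (rule cech_module)
  interpret D: module R "cech R fs M (Suc k)" by (rule cech_module)
  show ?thesis
    using assms by (auto simp: cech_cocycles_def cech_diff_add)
qed

lemma cech_cocycles_zero: "\<zero>\<^bsub>cech R fs M k\<^esub> \<in> cech_cocycles R fs M k"
proof -
  interpret C: module R "cech R fs M k" by (rule cech_module)
  show ?thesis
    by (simp add: cech_cocycles_def cech_diff_zero)
qed

lemma cech_coboundaries_Suc:
  "cech_coboundaries R fs M (Suc k) = cech_diff R fs M k ` carrier (cech R fs M k)"
  by (simp add: cech_coboundaries_def)

lemma cech_coboundaries_smult:
  assumes "b \<in> cech_coboundaries R fs M (Suc k)" "r \<in> carrier R"
  shows "r \<odot>\<^bsub>cech R fs M (Suc k)\<^esub> b \<in> cech_coboundaries R fs M (Suc k)"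
proof -
  interpret C: module R "cech R fs M k" by (rule cech_module)
  from assms(1) obtain c where c: "c \<in> carrier (cech R fs M k)" "b = cech_diff R fs M k c"
    unfolding cech_coboundaries_Suc by blast
  then have "r \<odot>\<^bsub>cech R fs M (Suc k)\<^esub> b = cech_diff R fs M k (r \<odot>\<^bsub>cech R fs M k\<^esub> c)"
    using assms(2) by (simp add: cech_diff_smult)
  then show ?thesis
    using C.smult_closed[OF assms(2) c(1)] unfolding cech_coboundaries_Suc by simp
qed

lemma cech_coboundaries_subgroup:
  "abelian_subgroup (cech_coboundaries R fs M (Suc k)) (cech R fs M (Suc k))"
proof -
  interpret C: module R "cech R fs M k" by (rule cech_module)
  interpret D: module R "cech R fs M (Suc k)" by (rule cech_module)
  let ?B = "cech_coboundaries R fs M (Suc k)"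
  have "\<ominus>\<^bsub>cech R fs M (Suc k)\<^esub> b \<in> ?B" if "b \<in> ?B" for b
  proof -
    have "b \<in> carrier (cech R fs M (Suc k))"
      using that cech_diff_closed unfolding cech_coboundaries_Suc by blast
    then have "\<ominus>\<^bsub>cech R fs M (Suc k)\<^esub> b = (\<ominus> \<one>) \<odot>\<^bsub>cech R fs M (Suc k)\<^esub> b"
      by (simp add: D.smult_l_minus)
    then show ?thesis
      using cech_coboundaries_smult[OF that] by simp
  qed
  moreover have "x \<oplus>\<^bsub>cech R fs M (Suc k)\<^esub> y \<in> ?B" if "x \<in> ?B" "y \<in> ?B" for x y
  proof -
    from that obtain c c' where c: "c \<in> carrier (cech R fs M k)" "x = cech_diff R fs M k c"
      "c' \<in> carrier (cech R fs M k)" "y = cech_diff R fs M k c'"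
      unfolding cech_coboundaries_Suc by blast
    then have "x \<oplus>\<^bsub>cech R fs M (Suc k)\<^esub> y = cech_diff R fs M k (c \<oplus>\<^bsub>cech R fs M k\<^esub> c')"
      by (simp add: cech_diff_add)
    then show ?thesis
      using C.M.a_closed[OF c(1,3)] unfolding cech_coboundaries_Suc by simp
  qed
  moreover have "\<zero>\<^bsub>cech R fs M (Suc k)\<^esub> \<in> ?B"
    using cech_diff_zero[of k] C.M.zero_closed unfolding cech_coboundaries_Suc by (metis imageI)
  moreover have "?B \<subseteq> carrier (cech R fs M (Suc k))"
    using cech_diff_closed unfolding cech_coboundaries_Suc by blast
  ultimately have "additive_subgroup ?B (cech R fs M (Suc k))"
    unfolding additive_subgroup_def
    by (intro D.add.subgroupI) (auto simp: a_inv_def)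
  then show ?thesis
    by (intro abelian_subgroupI3 D.M.abelian_group_axioms)
qed

text \<open>The scalar action is a union over all elements of a coset. Coboundaries are closed under
  scalars, so every element of the coset contributes the same set.\<close>

lemma coset_smult:
  assumes z: "z \<in> carrier (cech R fs M (Suc k))" and r: "r \<in> carrier R"
  shows "r \<odot>\<^bsub>local_cohomology R fs M (Suc k)\<^esub> (cech_coboundaries R fs M (Suc k) +>\<^bsub>cech R fs M (Suc k)\<^esub> z) =
    cech_coboundaries R fs M (Suc k) +>\<^bsub>cech R fs M (Suc k)\<^esub> (r \<odot>\<^bsub>cech R fs M (Suc k)\<^esub> z)"
proof -
  let ?C = "cech R fs M (Suc k)" and ?B = "cech_coboundaries R fs M (Suc k)"
  interpret C: module R ?C by (rule cech_module)
  interpret B: abelian_subgroup ?B ?C by (rule cech_coboundaries_subgroup)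
  have eq: "?B +>\<^bsub>?C\<^esub> (r \<odot>\<^bsub>?C\<^esub> w) = ?B +>\<^bsub>?C\<^esub> (r \<odot>\<^bsub>?C\<^esub> z)" if "w \<in> ?B +>\<^bsub>?C\<^esub> z" for w
  proof -
    from that obtain b where b: "b \<in> ?B" "w = b \<oplus>\<^bsub>?C\<^esub> z"
      unfolding a_r_coset_def' by blast
    then have "r \<odot>\<^bsub>?C\<^esub> w = r \<odot>\<^bsub>?C\<^esub> b \<oplus>\<^bsub>?C\<^esub> r \<odot>\<^bsub>?C\<^esub> z"
      using z r B.a_subset by (auto intro: C.smult_r_distr)
    moreover have "r \<odot>\<^bsub>?C\<^esub> b \<in> ?B"
      using b(1) r by (rule cech_coboundaries_smult)
    ultimately have "r \<odot>\<^bsub>?C\<^esub> w \<in> ?B +>\<^bsub>?C\<^esub> (r \<odot>\<^bsub>?C\<^esub> z)"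
      unfolding a_r_coset_def' by blast
    then show ?thesis
      using B.a_repr_independence' C.smult_closed[OF r z] by metis
  qed
  have "z \<in> ?B +>\<^bsub>?C\<^esub> z"
    using z by (rule B.a_rcos_self)
  then have "(\<Union>w\<in>?B +>\<^bsub>?C\<^esub> z. ?B +>\<^bsub>?C\<^esub> (r \<odot>\<^bsub>?C\<^esub> w)) = ?B +>\<^bsub>?C\<^esub> (r \<odot>\<^bsub>?C\<^esub> z)"
    using eq by blast
  then show ?thesis
    by (simp add: local_cohomology_def)
qed

lemma coset_add:
  assumes "z \<in> carrier (cech R fs M (Suc k))" "w \<in> carrier (cech R fs M (Suc k))"
  shows "(cech_coboundaries R fs M (Suc k) +>\<^bsub>cech R fs M (Suc k)\<^esub> z) \<oplus>\<^bsub>local_cohomology R fs M (Suc k)\<^esub>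
      (cech_coboundaries R fs M (Suc k) +>\<^bsub>cech R fs M (Suc k)\<^esub> w) =
    cech_coboundaries R fs M (Suc k) +>\<^bsub>cech R fs M (Suc k)\<^esub> (z \<oplus>\<^bsub>cech R fs M (Suc k)\<^esub> w)"
  using abelian_subgroup.a_rcos_sum[OF cech_coboundaries_subgroup assms]
  by (simp add: local_cohomology_def)

lemma coset_zero:
  "cech_coboundaries R fs M (Suc k) +>\<^bsub>cech R fs M (Suc k)\<^esub> \<zero>\<^bsub>cech R fs M (Suc k)\<^esub> =
    \<zero>\<^bsub>local_cohomology R fs M (Suc k)\<^esub>"
proof -
  interpret C: module R "cech R fs M (Suc k)" by (rule cech_module)
  interpret B: abelian_subgroup "cech_coboundaries R fs M (Suc k)" "cech R fs M (Suc k)"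
    by (rule cech_coboundaries_subgroup)
  show ?thesis
    by (simp add: local_cohomology_def C.M.a_coset_join2[OF C.M.zero_closed B.a_subgroup B.zero_closed])
qed

lemma coset_eq_zeroD:
  assumes "z \<in> carrier (cech R fs M (Suc k))"
    and "cech_coboundaries R fs M (Suc k) +>\<^bsub>cech R fs M (Suc k)\<^esub> z = \<zero>\<^bsub>local_cohomology R fs M (Suc k)\<^esub>"
  shows "z \<in> cech_coboundaries R fs M (Suc k)"
  using assms abelian_subgroup.a_rcos_self[OF cech_coboundaries_subgroup assms(1)]
  by (simp add: local_cohomology_def)

end

section \<open>Graded pieces of the Cech complex and its cohomology\<close>

locale graded_cech_complex = cech_complex R M fs for R (structure) and M (structure) and fs +
  fixes K :: "('k, 'l) ring_scheme" and \<phi> and G :: "int \<Rightarrow> _ set"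
  assumes K: "cring K" and phi: "\<phi> \<in> ring_hom K R"
    and G_subset: "G d \<subseteq> carrier M"
    and G_zero: "\<zero>\<^bsub>M\<^esub> \<in> G d"
    and G_add: "a \<in> G d \<Longrightarrow> b \<in> G d \<Longrightarrow> a \<oplus>\<^bsub>M\<^esub> b \<in> G d"
    and G_scale: "c \<in> carrier K \<Longrightarrow> a \<in> G d \<Longrightarrow> \<phi> c \<odot>\<^bsub>M\<^esub> a \<in> G d"
    and G_shift: "f \<in> set fs \<Longrightarrow> a \<in> G d \<Longrightarrow> f \<odot>\<^bsub>M\<^esub> a \<in> G (d + 1)"
begin

lemma phi_closed: "c \<in> carrier K \<Longrightarrow> \<phi> c \<in> carrier R"
  using phi by (rule ring_hom_closed)

lemma G_closed: "a \<in> G d \<Longrightarrow> a \<in> carrier M"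
  using G_subset by blast

text \<open>Each factor raises the degree by one, by \<open>G_shift\<close>. This allows two
  fractions of the same degree to be brought to a common denominator without a change of
  degree.\<close>

lemma G_cech_prod:
  assumes "S \<in> cech_index fs k" "a \<in> G d"
  shows "cech_prod R fs S \<odot>\<^bsub>M\<^esub> a \<in> G (d + int (card S))"
proof -
  have "finprod R (\<lambda>i. fs ! i) S \<odot>\<^bsub>M\<^esub> a \<in> G (d + int (card S))"
    if "finite S" "S \<subseteq> {..<length fs}" for S
    using that
  proof (induction S)
    case empty
    then show ?case using assms(2) G_closed[OF assms(2)] by simp
  next
    case (insert i S)
    have nth: "fs ! j \<in> carrier R" if "j \<in> insert i S" for j
      using that insert.prems fs nth_mem[of j fs] by (auto simp: subset_iff)
    have "fs ! i \<odot>\<^bsub>M\<^esub> (finprod R (\<lambda>i. fs ! i) S \<odot>\<^bsub>M\<^esub> a) \<in> G (d + int (card S) + 1)"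
      using insert by (intro G_shift) auto
    moreover have "finprod R (\<lambda>i. fs ! i) (insert i S) = fs ! i \<otimes> finprod R (\<lambda>i. fs ! i) S"
      using insert.hyps nth by (intro R.finprod_insert) auto
    moreover have "finprod R (\<lambda>i. fs ! i) S \<in> carrier R"
      using nth by (intro R.finprod_closed) auto
    ultimately show ?case
      using insert.hyps G_closed[OF assms(2)] nth by (simp add: smult_assoc1 ac_simps)
  qed
  then show ?thesis
    using assms(1) cech_index_finite[OF assms(1)] by (auto simp: cech_prod_def cech_index_def)
qed

lemma G_cech_prod_pow:
  assumes S: "S \<in> cech_index fs k" and a: "a \<in> G d"
  shows "(cech_prod R fs S [^] (n::nat)) \<odot>\<^bsub>M\<^esub> a \<in> G (d + int n * int (card S))"
proof (induction n)
  case 0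
  show ?case using a G_closed[OF a] by simp
next
  case (Suc n)
  have "cech_prod R fs S \<odot>\<^bsub>M\<^esub> ((cech_prod R fs S [^] n) \<odot>\<^bsub>M\<^esub> a) \<in> G (d + int n * int (card S) + int (card S))"
    using S Suc by (rule G_cech_prod)
  then show ?case
    using cech_prod_closed[OF S] G_closed[OF a]
    by (simp add: smult_assoc1[symmetric] R.m_comm algebra_simps)
qed

lemma cech_piece_subset: "cech_piece R fs M G k d \<subseteq> carrier (cech R fs M k)"
  unfolding cech_piece_def cech_def cech_loc_def
  using G_subset by (auto simp: localisation_carrier intro!: PiE_mono)

lemma cech_pieceI:
  assumes "c \<in> carrier (cech R fs M k)"
    and "\<And>S. S \<in> cech_index fs k \<Longrightarrow>
      \<exists>a n. c S = frac R M (cech_prod R fs S) a n \<and> a \<in> G (d + int n * int (card S))"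
  shows "c \<in> cech_piece R fs M G k d"
  using assms by (auto simp: cech_piece_def cech_def PiE_iff)

lemma cech_pieceD:
  assumes "c \<in> cech_piece R fs M G k d" "S \<in> cech_index fs k"
  obtains a n where "c S = frac R M (cech_prod R fs S) a n" "a \<in> G (d + int n * int (card S))" "a \<in> carrier M"
  using assms G_subset by (fastforce simp: cech_piece_def PiE_iff)

lemma cech_piece_zero: "\<zero>\<^bsub>cech R fs M k\<^esub> \<in> cech_piece R fs M G k d"
proof (rule cech_pieceI)
  interpret C: module R "cech R fs M k" by (rule cech_module)
  show "\<zero>\<^bsub>cech R fs M k\<^esub> \<in> carrier (cech R fs M k)" by simp
  fix S assume "S \<in> cech_index fs k"
  then show "\<exists>a n. \<zero>\<^bsub>cech R fs M k\<^esub> S = frac R M (cech_prod R fs S) a n \<and> a \<in> G (d + int n * int (card S))"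
    by (intro exI[of _ "\<zero>\<^bsub>M\<^esub>"] exI[of _ 0]) (simp add: cech_zero_component cech_loc_def localisation_zero G_zero)
qed

lemma cech_piece_add:
  assumes c: "c \<in> cech_piece R fs M G k d" "c' \<in> cech_piece R fs M G k d"
  shows "c \<oplus>\<^bsub>cech R fs M k\<^esub> c' \<in> cech_piece R fs M G k d"
proof (rule cech_pieceI)
  interpret C: module R "cech R fs M k" by (rule cech_module)
  show "c \<oplus>\<^bsub>cech R fs M k\<^esub> c' \<in> carrier (cech R fs M k)"
    using c cech_piece_subset by blast
  fix S assume S: "S \<in> cech_index fs k"
  let ?f = "cech_prod R fs S"
  obtain a n where a: "c S = frac R M ?f a n" "a \<in> G (d + int n * int (card S))" "a \<in> carrier M"
    using c(1) S by (rule cech_pieceD)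
  obtain b m where b: "c' S = frac R M ?f b m" "b \<in> G (d + int m * int (card S))" "b \<in> carrier M"
    using c(2) S by (rule cech_pieceD)
  have "(c \<oplus>\<^bsub>cech R fs M k\<^esub> c') S = frac R M ?f ((?f [^] m) \<odot>\<^bsub>M\<^esub> a \<oplus>\<^bsub>M\<^esub> (?f [^] n) \<odot>\<^bsub>M\<^esub> b) (n + m)"
    using a b cech_prod_closed[OF S] by (simp add: cech_add_component[OF S] cech_loc_def localisation_add)
  moreover have "(?f [^] m) \<odot>\<^bsub>M\<^esub> a \<oplus>\<^bsub>M\<^esub> (?f [^] n) \<odot>\<^bsub>M\<^esub> b \<in> G (d + int (n + m) * int (card S))"
    using G_cech_prod_pow[OF S a(2), of m] G_cech_prod_pow[OF S b(2), of n]
    by (intro G_add) (simp_all add: algebra_simps)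
  ultimately show "\<exists>a n. (c \<oplus>\<^bsub>cech R fs M k\<^esub> c') S = frac R M ?f a n \<and> a \<in> G (d + int n * int (card S))"
    by blast
qed

lemma cech_piece_smult:
  assumes c: "c \<in> cech_piece R fs M G k d" and r: "r \<in> carrier K"
  shows "\<phi> r \<odot>\<^bsub>cech R fs M k\<^esub> c \<in> cech_piece R fs M G k d"
proof (rule cech_pieceI)
  interpret C: module R "cech R fs M k" by (rule cech_module)
  show "\<phi> r \<odot>\<^bsub>cech R fs M k\<^esub> c \<in> carrier (cech R fs M k)"
    using c cech_piece_subset phi_closed[OF r] by blast
  fix S assume S: "S \<in> cech_index fs k"
  let ?f = "cech_prod R fs S"
  obtain a n where a: "c S = frac R M ?f a n" "a \<in> G (d + int n * int (card S))" "a \<in> carrier M"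
    using c S by (rule cech_pieceD)
  have "(\<phi> r \<odot>\<^bsub>cech R fs M k\<^esub> c) S = frac R M ?f (\<phi> r \<odot>\<^bsub>M\<^esub> a) n"
    using a cech_prod_closed[OF S] phi_closed[OF r]
    by (simp add: cech_smult_component[OF S] cech_loc_def localisation_smult)
  with G_scale[OF r a(2)]
  show "\<exists>a n. (\<phi> r \<odot>\<^bsub>cech R fs M k\<^esub> c) S = frac R M ?f a n \<and> a \<in> G (d + int n * int (card S))"
    by blast
qed

text \<open>The cocycles in a graded piece are closed under addition and the scalars from
  \<open>K\<close>. The coset map carries their module structure onto the piece of the
  cohomology.\<close>

lemma local_cohomology_piece_module:
  "module K (restrict_scalars \<phi> (local_cohomology R fs M (Suc k)) (local_cohomology_piece R fs M G (Suc k) d))"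
proof (rule module_surjI)
  let ?C = "cech R fs M (Suc k)" and ?B = "cech_coboundaries R fs M (Suc k)"
  let ?P = "cech_cocycles R fs M (Suc k) \<inter> cech_piece R fs M G (Suc k) d"
  have sub: "?P \<subseteq> carrier ?C"
    using cech_piece_subset by blast
  show "module K (restrict_scalars \<phi> ?C ?P)"
    by (rule restrict_scalars_module[OF cech_module K phi sub])
      (auto intro: cech_cocycles_zero cech_piece_zero cech_cocycles_add cech_piece_add
        cech_cocycles_smult cech_piece_smult phi_closed)
  show "(\<lambda>z. ?B +>\<^bsub>?C\<^esub> z) ` carrier (restrict_scalars \<phi> ?C ?P) =
      carrier (restrict_scalars \<phi> (local_cohomology R fs M (Suc k)) (local_cohomology_piece R fs M G (Suc k) d))"
    by (auto simp: restrict_scalars_def local_cohomology_piece_def)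
qed (use cech_piece_subset in \<open>auto simp: restrict_scalars_def coset_add coset_smult coset_zero phi_closed subset_iff\<close>)

end

section \<open>Polynomials\<close>

text \<open>With an order on the indeterminates, the polynomial ring is an instance of \<^class>\<open>idom\<close>.\<close>

instantiation indet :: linorder
begin

primrec indet_rank :: "indet \<Rightarrow> nat" where
  "indet_rank Iu = 0" | "indet_rank Iv = 1" | "indet_rank Iw = 2"
| "indet_rank Ix = 3" | "indet_rank Iy = 4" | "indet_rank Iz = 5"

definition less_eq_indet :: "indet \<Rightarrow> indet \<Rightarrow> bool" where
  "i \<le> j \<longleftrightarrow> indet_rank i \<le> indet_rank j"

definition less_indet :: "indet \<Rightarrow> indet \<Rightarrow> bool" where
  "i < j \<longleftrightarrow> indet_rank i < indet_rank j"

instance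
proof
  fix i j :: indet
  assume "i \<le> j" "j \<le> i"
  then show "i = j"
    by (cases i; cases j) (auto simp: less_eq_indet_def)
qed (auto simp: less_eq_indet_def less_indet_def)

end

text \<open>The Frobenius identities are applied to polynomials, whereas the characteristic is given
  for the coefficients.\<close>

lemma CHAR_poly_mapping:
  "CHAR('b::comm_monoid_add \<Rightarrow>\<^sub>0 'a::comm_semiring_1) = CHAR('a)"
  by (rule CHAR_eqI)
    (auto simp: of_nat_eq_0_iff_char_dvd
      simp flip: single_of_nat dest!: arg_cong[where f = "\<lambda>p. Poly_Mapping.lookup p 0"])

section \<open>Truncation of polynomials to selected monomials\<close>

lift_definition terms_satisfying :: "('b \<Rightarrow> bool) \<Rightarrow> ('b \<Rightarrow>\<^sub>0 'a::zero) \<Rightarrow> 'b \<Rightarrow>\<^sub>0 'a"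
  is "\<lambda>P f e. f e when P e"
  by (rule finite_subset) auto

lemma terms_satisfying_0 [simp]: "terms_satisfying P 0 = 0"
  by transfer auto

lemma terms_satisfying_add:
  "terms_satisfying P (f + g) = terms_satisfying P f + terms_satisfying P (g :: _ \<Rightarrow>\<^sub>0 'a::monoid_add)"
  by transfer (auto simp: when_def)

lemma terms_satisfying_diff:
  "terms_satisfying P (f - g) = terms_satisfying P f - terms_satisfying P (g :: _ \<Rightarrow>\<^sub>0 'a::ab_group_add)"
  by transfer (auto simp: when_def)

lemma terms_satisfying_single:
  "terms_satisfying P (Poly_Mapping.single e c) = (if P e then Poly_Mapping.single e c else 0)"
  by transfer (auto simp: when_def)

text \<open>A product of monomials satisfies \<open>P\<close> exactly if both factors do, so
  discarding the other terms respects products. If \<open>P\<close> forbids certain indeterminates,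
  truncation is substitution of zero for them.\<close>

lemma terms_satisfying_mult:
  fixes f g :: "'b::monoid_add \<Rightarrow>\<^sub>0 'a::semiring_0"
  assumes P: "\<And>d e. P (d + e) \<longleftrightarrow> P d \<and> P e"
  shows "terms_satisfying P (f * g) = terms_satisfying P f * terms_satisfying P g"
proof (rule poly_mapping_eqI)
  fix k
  have eq: "(Poly_Mapping.lookup f l * Sum_any (\<lambda>q. Poly_Mapping.lookup g q when k = l + q) when P k) =
     (Poly_Mapping.lookup f l when P l) * Sum_any (\<lambda>q. (Poly_Mapping.lookup g q when P q) when k = l + q)" for l
  proof (cases "P k \<and> P l")
    case True
    have "(Poly_Mapping.lookup g q when k = l + q) = ((Poly_Mapping.lookup g q when P q) when k = l + q)" for q
      using P True by (auto simp: when_def)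
    then show ?thesis using True by simp
  next
    case False
    then consider "P k" "\<not> P l" | "\<not> P k" "\<not> P l" | "\<not> P k" "P l"
      by blast
    then show ?thesis
    proof cases
      case 1
      then have "(Poly_Mapping.lookup g q when k = l + q) = 0" for q
        using P by (auto simp: when_def)
      then show ?thesis using 1 by simp
    next
      case 3
      then have "((Poly_Mapping.lookup g q when P q) when k = l + q) = 0" for q
        using P by (auto simp: when_def)
      then show ?thesis using 3 by simp
    qed simp
  qed
  have "Poly_Mapping.lookup (terms_satisfying P (f * g)) k = (Poly_Mapping.lookup (f * g) k when P k)"
    by (simp add: terms_satisfying.rep_eq)
  also have "\<dots> = Sum_any (\<lambda>l. Poly_Mapping.lookup f l * Sum_any (\<lambda>q. Poly_Mapping.lookup g q when k = l + q) when P k)"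
    unfolding lookup_mult by (cases "P k") simp_all
  also have "\<dots> = Poly_Mapping.lookup (terms_satisfying P f * terms_satisfying P g) k"
    unfolding lookup_mult terms_satisfying.rep_eq using eq by simp
  finally show "Poly_Mapping.lookup (terms_satisfying P (f * g)) k =
    Poly_Mapping.lookup (terms_satisfying P f * terms_satisfying P g) k" .
qed

lemma Var_power: "Var i ^ n = Poly_Mapping.single (Poly_Mapping.single i n) (1 :: 'a::comm_ring_1)"
  by (induction n) (simp_all add: Var_def mult_single single_add[symmetric])

text \<open>This discards multiples of a high power when a coefficient at a lower exponent is read
  off.\<close>

lemma lookup_Var_power_mult:
  fixes g :: "'a::comm_ring_1 poly6" and e :: "indet \<Rightarrow>\<^sub>0 nat"
  assumes "Poly_Mapping.lookup e i < n"
  shows "Poly_Mapping.lookup (Var i ^ n * g) e = 0"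
proof (rule ccontr)
  assume "Poly_Mapping.lookup (Var i ^ n * g) e \<noteq> 0"
  then have "e \<in> Poly_Mapping.keys (Var i ^ n * g)"
    by (simp add: in_keys_iff)
  then obtain a b where "e = a + b" "a \<in> Poly_Mapping.keys (Var i ^ n :: 'a poly6)"
    using keys_mult[of "Var i ^ n" g] by blast
  then show False
    using assms by (auto simp: Var_power lookup_add split: if_splits)
qed

section \<open>Binary forms and Frobenius\<close>

lemma diff_power_CHAR:
  fixes f g :: "'a::comm_ring_1"
  assumes "prime CHAR('a)" "r = CHAR('a) ^ e"
  shows "(f - g) ^ r = f ^ r - g ^ r"
  using freshmans_dream'[OF assms, of "f - g" g] by simp

text \<open>This is \<open>a ^ n\<close> times the sum of \<open>c i * (b / a) ^ i\<close>, that is,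
  the numerator over \<open>a ^ n\<close> of a linear combination of powers of one fraction.\<close>

definition binary_form :: "nat \<Rightarrow> (nat \<Rightarrow> 'a) \<Rightarrow> 'a poly6 \<Rightarrow> 'a poly6 \<Rightarrow> 'a::comm_ring_1 poly6" where
  "binary_form n c a b = (\<Sum>i<n. Const (c i) * a ^ (n - i) * b ^ i)"

text \<open>Both sides are the sum of \<open>c i * ((d / a) ^ i - (e / b) ^ i)\<close>, cleared of
  denominators by the factor \<open>(a * b) ^ n\<close>.\<close>

lemma binary_form_antisymmetrized:
  "b ^ n * binary_form n c a d - a ^ n * binary_form n c b e =
    (\<Sum>i<n. Const (c i) * (a * b) ^ (n - i) * ((b * d) ^ i - (a * e) ^ i))"
proof -
  have "b ^ n * (Const (c i) * a ^ (n - i) * d ^ i) - a ^ n * (Const (c i) * b ^ (n - i) * e ^ i) =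
      Const (c i) * (a * b) ^ (n - i) * ((b * d) ^ i - (a * e) ^ i)" if "i < n" for i
  proof -
    define k where "k = n - i"
    then have n: "n = i + k"
      using that by simp
    show ?thesis
      unfolding n diff_add_inverse power_add power_mult_distrib right_diff_distrib
      by (simp only: ac_simps)
  qed
  then show ?thesis
    unfolding binary_form_def sum_distrib_left sum_subtractf[symmetric]
    by (intro sum.cong) auto
qed

lemma binary_form_add: "binary_form n (\<lambda>i. c i + c' i) a b = binary_form n c a b + binary_form n c' a b"
  by (simp add: binary_form_def Const_def single_add distrib_right sum.distrib)

lemma binary_form_scale: "binary_form n (\<lambda>i. k * c i) a b = Const k * binary_form n c a b"
proof -
  have "Const (k * x) = Const k * Const x" for x
    by (simp add: Const_def mult_single)
  then show ?thesis
    by (simp add: binary_form_def sum_distrib_left mult.assoc)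
qed

text \<open>As \<open>r\<close> is a power of the characteristic, \<open>(b * d - a * f) ^ r\<close>
  equals \<open>(b * d) ^ r - (a * f) ^ r\<close>. This divides the difference of the
  \<open>i\<close>-th powers if \<open>r dvd i\<close>, and all other coefficients vanish.\<close>

lemma binary_form_antisymmetrized_dvd:
  fixes c :: "nat \<Rightarrow> 'a::field"
  assumes p: "prime CHAR('a)" "r = CHAR('a) ^ e" and c: "\<And>i. c i \<noteq> 0 \<Longrightarrow> r dvd i"
  shows "(b * d - a * f) ^ r dvd b ^ n * binary_form n c a d - a ^ n * binary_form n c b f"
  unfolding binary_form_antisymmetrized
proof (rule dvd_sum)
  fix i
  have "(b * d - a * f) ^ r dvd (b * d) ^ i - (a * f) ^ i" if ri: "r dvd i"
  proof -
    obtain m where i: "i = r * m" using ri by (rule dvdE)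
    have "(b * d - a * f) ^ r = (b * d) ^ r - (a * f) ^ r"
      by (rule diff_power_CHAR) (simp_all add: CHAR_poly_mapping p)
    also have "\<dots> dvd ((b * d) ^ r) ^ m - ((a * f) ^ r) ^ m"
      unfolding power_diff_sumr2[of "(b * d) ^ r" m] by simp
    finally show ?thesis by (simp only: i power_mult)
  qed
  then show "(b * d - a * f) ^ r dvd Const (c i) * (a * b) ^ (n - i) * ((b * d) ^ i - (a * f) ^ i)"
    using c[of i] by (cases "c i = 0") (simp_all add: Const_def)
qed

section \<open>Recovering the coefficients of a binary form\<close>

lemma Var_binomial_neq_0: "Var Iu * Var Iy - Var Iv * Var Ix \<noteq> (0 :: 'a::field poly6)"
proof
  let ?e = "Poly_Mapping.single Iu 1 + Poly_Mapping.single Iy 1 :: indet \<Rightarrow>\<^sub>0 nat"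
  have "Poly_Mapping.single Iv 1 + Poly_Mapping.single Ix 1 \<noteq> ?e"
    by (auto dest!: arg_cong[where f = "\<lambda>e. Poly_Mapping.lookup e Iu"] simp: lookup_add lookup_single)
  then have "Poly_Mapping.lookup (Var Iu * Var Iy - Var Iv * Var Ix :: 'a poly6) ?e = 1"
    by (simp add: Var_def mult_single lookup_minus lookup_single when_def)
  moreover assume "Var Iu * Var Iy - Var Iv * Var Ix = (0 :: 'a poly6)"
  ultimately show False by simp
qed

definition expo :: "nat \<Rightarrow> nat \<Rightarrow> nat \<Rightarrow> nat \<Rightarrow> indet \<Rightarrow>\<^sub>0 nat" where
  "expo i j k l = Poly_Mapping.single Iu i + Poly_Mapping.single Iv j +
     Poly_Mapping.single Ix k + Poly_Mapping.single Iy l"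

lemma expo_eq_iff: "expo i j k l = expo i' j' k' l' \<longleftrightarrow> i = i' \<and> j = j' \<and> k = k' \<and> l = l'"
proof
  assume eq: "expo i j k l = expo i' j' k' l'"
  show "i = i' \<and> j = j' \<and> k = k' \<and> l = l'"
    using arg_cong[OF eq, of "\<lambda>e. Poly_Mapping.lookup e Iu"] arg_cong[OF eq, of "\<lambda>e. Poly_Mapping.lookup e Iv"]
      arg_cong[OF eq, of "\<lambda>e. Poly_Mapping.lookup e Ix"] arg_cong[OF eq, of "\<lambda>e. Poly_Mapping.lookup e Iy"]
    by (simp add: expo_def lookup_add lookup_single)
qed simp

text \<open>After cancellation of \<open>D ^ Suc q\<close> the equation puts a sum of monomials into
  the ideal generated by the powers with exponent \<open>N + 2 * q\<close> of the four
  indeterminates. There a monomial with all exponents smaller has coefficient zero, and for each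
  \<open>i\<close> in the range there is one with coefficient \<open>c i\<close> in the sum.\<close>

lemma binary_form_coeff_eq_0:
  fixes c :: "nat \<Rightarrow> 'a::field"
  defines "(u :: 'a poly6) \<equiv> Var Iu" and "(v :: 'a poly6) \<equiv> Var Iv"
    and "(x :: 'a poly6) \<equiv> Var Ix" and "(y :: 'a poly6) \<equiv> Var Iy"
  defines "D \<equiv> u * y - v * x"
  assumes eq: "(u * v * x * y) ^ N *
      (v ^ (2 * q) * binary_form (2 * q) c u x - u ^ (2 * q) * binary_form (2 * q) c v y) *
      (x * y) ^ q * D ^ q =
      D ^ t * (u ^ (N + 2 * q) * g1 + v ^ (N + 2 * q) * g2 + x ^ (N + 2 * q) * g3 + y ^ (N + 2 * q) * g4)"
    and t: "q < t" and i: "0 < i" "i < 2 * q"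
  shows "c i = 0"
proof -
  \<comment> \<open>The exponent of the typical term \<open>(u * v * x * y) ^ N * (x * y) ^ q * (u *
    v) ^ (2 * q - i) * (u * y) ^ (i - Suc j) * (v * x) ^ j\<close> of the expansion.\<close>
  define m where "m i j = expo (N + (2 * q - i) + (i - Suc j)) (N + (2 * q - i) + j) (N + q + j)
    (N + q + (i - Suc j))" for i j
  have "D \<noteq> 0"
    unfolding D_def u_def v_def x_def y_def by (rule Var_binomial_neq_0)
  \<comment> \<open>Beside the visible \<open>D ^ q\<close>, one more factor comes from the
    differences of \<open>i\<close>-th powers, which are divisible by
    \<open>v * x - u * y = - D\<close>. On the other side \<open>D ^ Suc q\<close> splits off
    because \<open>q < t\<close>.\<close>
  have "D ^ Suc q * ((u * v * x * y) ^ N * (x * y) ^ q *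
      (\<Sum>i<2*q. Const (c i) * (u * v) ^ (2 * q - i) * (\<Sum>j<i. (u * y) ^ (i - Suc j) * (v * x) ^ j))) =
      D ^ Suc q * (D ^ (t - Suc q) * - (u ^ (N + 2 * q) * g1 + v ^ (N + 2 * q) * g2 + x ^ (N + 2 * q) * g3
        + y ^ (N + 2 * q) * g4))" (is "_ * ?L = _ * (_ * - ?R)")
  proof -
    have "D ^ t = D ^ Suc q * D ^ (t - Suc q)"
      using t unfolding power_add[symmetric] by simp
    moreover have "v * x - u * y = - D"
      by (simp add: D_def)
    moreover have "v ^ (2 * q) * binary_form (2 * q) c u x - u ^ (2 * q) * binary_form (2 * q) c v y =
        (v * x - u * y) * (\<Sum>i<2*q. Const (c i) * (u * v) ^ (2 * q - i) *
          (\<Sum>j<i. (u * y) ^ (i - Suc j) * (v * x) ^ j))"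
      unfolding binary_form_antisymmetrized power_diff_sumr2[of "v * x"] sum_distrib_left
      by (simp only: ac_simps)
    ultimately show ?thesis
      using eq by (simp only: power_Suc mult_minus_left mult_minus_right minus_equation_iff ac_simps)
  qed
  then have LR: "?L = D ^ (t - Suc q) * - ?R"
    using \<open>D \<noteq> 0\<close> by (subst (asm) mult_left_cancel) (simp_all only: power_not_zero simp_thms)
  have L: "?L = (\<Sum>i<2*q. \<Sum>j<i. Poly_Mapping.single (m i j) (c i))"
  proof -
    have "(u * v * x * y) ^ N * (x * y) ^ q * (Const (c i) * (u * v) ^ (2 * q - i) *
        ((u * y) ^ (i - Suc j) * (v * x) ^ j)) = Poly_Mapping.single (m i j) (c i)" for i j
    proof -
      have "Poly_Mapping.single (m i j) (c i) =
          Const (c i) * (u ^ (N + (2 * q - i) + (i - Suc j)) * v ^ (N + (2 * q - i) + j) *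
          x ^ (N + q + j) * y ^ (N + q + (i - Suc j)))"
        by (simp add: u_def v_def x_def y_def Var_power Const_def m_def expo_def mult_single)
      then show ?thesis
        by (simp only: power_add power_mult_distrib ac_simps)
    qed
    then show ?thesis
      by (simp add: sum_distrib_left mult.assoc)
  qed
  \<comment> \<open>If \<open>i \<le> q\<close>, then \<open>i - Suc j\<close> is zero; otherwise
    \<open>j = q - 1\<close> and \<open>i - Suc j = i - q\<close>. So both numbers stay below
    \<open>q\<close>, which keeps all four exponents of \<open>m i j\<close> below
    \<open>N + 2 * q\<close>.\<close>
  define j where "j = min (i - 1) (q - 1)"
  have j: "j < i" "j < q" "i - Suc j < q"
    using i by (auto simp: j_def)
  have "Poly_Mapping.lookup ?L (m i j) = (\<Sum>i'<2*q. \<Sum>j'<i'. (c i' when m i' j' = m i j))"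
    unfolding L by (simp add: lookup_sum lookup_single)
  also have "\<dots> = (\<Sum>i'<2*q. if i' = i then c i else 0)"
  proof (rule sum.cong)
    fix i' assume "i' \<in> {..<2*q}"
    \<comment> \<open>The exponent of \<open>Ix\<close> determines \<open>j\<close>, and then that
      of \<open>Iv\<close> determines \<open>i\<close>.\<close>
    have "i' = i \<and> j' = j" if "m i' j' = m i j" "j' < i'" for j'
      using that j i \<open>i' \<in> _\<close> by (auto simp: m_def expo_eq_iff)
    then have "(\<Sum>j'<i'. (c i' when m i' j' = m i j)) = (\<Sum>j'<i'. if j' = j then (if i' = i then c i else 0) else 0)"
      by (intro sum.cong) (auto simp: when_def)
    also have "\<dots> = (if i' = i then c i else 0)"
      using j by auto
    finally show "(\<Sum>j'<i'. (c i' when m i' j' = m i j)) = (if i' = i then c i else 0)" .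
  qed simp
  also have "\<dots> = c i"
    using i by simp
  finally have "c i = Poly_Mapping.lookup (D ^ (t - Suc q) * - ?R) (m i j)"
    unfolding LR by simp
  also have "D ^ (t - Suc q) * - ?R = - (u ^ (N + 2 * q) * (D ^ (t - Suc q) * g1) + v ^ (N + 2 * q) * (D ^ (t - Suc q) * g2) +
      x ^ (N + 2 * q) * (D ^ (t - Suc q) * g3) + y ^ (N + 2 * q) * (D ^ (t - Suc q) * g4))"
    by (simp add: algebra_simps)
  also have "Poly_Mapping.lookup \<dots> (m i j) = 0"
  proof -
    have "Poly_Mapping.lookup (m i j) Iu < N + 2 * q" "Poly_Mapping.lookup (m i j) Iv < N + 2 * q"
      "Poly_Mapping.lookup (m i j) Ix < N + 2 * q" "Poly_Mapping.lookup (m i j) Iy < N + 2 * q"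
      using i j by (auto simp: m_def expo_def lookup_add lookup_single)
    then show ?thesis
      by (simp add: lookup_add u_def v_def x_def y_def lookup_minus lookup_Var_power_mult)
  qed
  finally show ?thesis .
qed

section \<open>Homogeneous polynomials\<close>

lemma monom_degree_eq_sum:
  assumes "finite S" "Poly_Mapping.keys e \<subseteq> S"
  shows "monom_degree e = (\<Sum>i\<in>S. Poly_Mapping.lookup e i)"
  unfolding monom_degree_def using assms
  by (intro sum.mono_neutral_left) (auto simp: in_keys_iff)

lemma monom_degree_add: "monom_degree (d + e) = monom_degree d + monom_degree e"
proof -
  let ?S = "Poly_Mapping.keys d \<union> Poly_Mapping.keys e"
  have "monom_degree f = (\<Sum>i\<in>?S. Poly_Mapping.lookup f i)" if "Poly_Mapping.keys f \<subseteq> ?S" for f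
    using that by (intro monom_degree_eq_sum) auto
  then show ?thesis
    using keys_add[of d e] by (simp add: lookup_add sum.distrib)
qed

lemma homogeneous_zero: "0 \<in> homogeneous d"
  by (simp add: homogeneous_def)

lemma homogeneous_add: "f \<in> homogeneous d \<Longrightarrow> g \<in> homogeneous d \<Longrightarrow> f + g \<in> homogeneous d"
  using keys_add[of f g] by (auto simp: homogeneous_def)

lemma homogeneous_uminus: "f \<in> homogeneous d \<Longrightarrow> - f \<in> homogeneous d"
  by (auto simp: homogeneous_def in_keys_iff)

lemma homogeneous_diff: "f \<in> homogeneous d \<Longrightarrow> g \<in> homogeneous d \<Longrightarrow> f - g \<in> homogeneous d"
  using homogeneous_add[OF _ homogeneous_uminus, of f d g] by simp

lemma homogeneous_mult: "f \<in> homogeneous d \<Longrightarrow> g \<in> homogeneous e \<Longrightarrow> f * g \<in> homogeneous (d + e)"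
  using keys_mult[of f g] by (fastforce simp: homogeneous_def monom_degree_add)

lemma homogeneous_Const: "Const c \<in> homogeneous 0"
  by (simp add: homogeneous_def Const_def monom_degree_def)

lemma homogeneous_Var: "Var i \<in> homogeneous 1"
  by (simp add: homogeneous_def Var_def monom_degree_def)

lemma homogeneous_power: "f \<in> homogeneous d \<Longrightarrow> f ^ n \<in> homogeneous (int n * d)"
proof (induction n)
  case 0
  then show ?case by (simp add: homogeneous_def monom_degree_def flip: single_one)
next
  case (Suc n)
  then show ?case
    using homogeneous_mult[of f d "f ^ n" "int n * d"] by (simp add: algebra_simps)
qed

lemma homogeneous_sum: "(\<And>i. i \<in> S \<Longrightarrow> f i \<in> homogeneous d) \<Longrightarrow> sum f S \<in> homogeneous d"
  by (induction S rule: infinite_finite_induct) (auto intro: homogeneous_zero homogeneous_add)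

section \<open>Powers of the ideal of minors\<close>

context cring
begin

lemma ideal_pow_ideal:
  assumes "ideal I R"
  shows "ideal (I [^]\<^bsub>ideals_set R\<^esub> (n::nat)) R"
proof -
  interpret S: comm_monoid "ideals_set R" by (rule ideals_set_is_comm_monoid)
  have "I [^]\<^bsub>ideals_set R\<^esub> n \<in> carrier (ideals_set R)"
    using assms by (intro S.nat_pow_closed) (simp add: ideals_set_def)
  then show ?thesis by (simp add: ideals_set_def)
qed

lemma ideal_pow_mult_mem:
  assumes I: "ideal I R" and "a \<in> I [^]\<^bsub>ideals_set R\<^esub> (m::nat)" "b \<in> I [^]\<^bsub>ideals_set R\<^esub> (n::nat)"
  shows "a \<otimes> b \<in> I [^]\<^bsub>ideals_set R\<^esub> (m + n)"
proof -
  interpret S: comm_monoid "ideals_set R" by (rule ideals_set_is_comm_monoid)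
  have "I [^]\<^bsub>ideals_set R\<^esub> (m + n) = I [^]\<^bsub>ideals_set R\<^esub> m \<otimes>\<^bsub>ideals_set R\<^esub> I [^]\<^bsub>ideals_set R\<^esub> n"
    using I by (intro S.nat_pow_mult[symmetric]) (simp add: ideals_set_def)
  also have "\<dots> = ideal_prod R (I [^]\<^bsub>ideals_set R\<^esub> m) (I [^]\<^bsub>ideals_set R\<^esub> n)"
    by (simp add: ideals_set_def)
  finally show ?thesis
    using ideal_prod.prod[OF assms(2,3)] by simp
qed

lemma ideal_pow_1:
  assumes I: "ideal I R"
  shows "I [^]\<^bsub>ideals_set R\<^esub> (1::nat) = I"
proof -
  interpret S: comm_monoid "ideals_set R" by (rule ideals_set_is_comm_monoid)
  show ?thesis
    using I S.nat_pow_eone[of I] by (simp add: ideals_set_def)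
qed

lemma elem_pow_mem_ideal_pow:
  assumes I: "ideal I R" and a: "a \<in> I"
  shows "a [^] (n::nat) \<in> I [^]\<^bsub>ideals_set R\<^esub> n"
proof (induction n)
  case 0
  show ?case by (simp add: ideals_set_def)
next
  case (Suc n)
  then show ?case
    using ideal_pow_mult_mem[OF I Suc, of a 1] a ideal_pow_1[OF I] by simp
qed

lemma ideal_pow_antimono:
  assumes I: "ideal I R" and "m \<le> n"
  shows "I [^]\<^bsub>ideals_set R\<^esub> (n::nat) \<subseteq> I [^]\<^bsub>ideals_set R\<^esub> m"
  using \<open>m \<le> n\<close>
proof (induction n rule: dec_induct)
  case (step n)
  have "I [^]\<^bsub>ideals_set R\<^esub> Suc n = ideal_prod R (I [^]\<^bsub>ideals_set R\<^esub> n) I"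
    by (simp add: ideals_set_def)
  then have "I [^]\<^bsub>ideals_set R\<^esub> Suc n \<subseteq> I [^]\<^bsub>ideals_set R\<^esub> n"
    using ideal_prod_inter[OF ideal_pow_ideal[OF I] I, of n] by blast
  with step show ?case by blast
qed simp

end

lemma poly6_ring_cring: "cring (poly6_ring :: 'a::field poly6 ring)"
  by (rule cring_from_type_algebra)

lemma carrier_poly6 [simp]: "carrier (poly6_ring :: 'a::field poly6 ring) = UNIV"
  and zero_poly6 [simp]: "\<zero>\<^bsub>poly6_ring :: 'a::field poly6 ring\<^esub> = 0"
  and one_poly6 [simp]: "\<one>\<^bsub>poly6_ring :: 'a::field poly6 ring\<^esub> = 1"
  and add_poly6 [simp]: "f \<oplus>\<^bsub>poly6_ring :: 'a::field poly6 ring\<^esub> g = f + g"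
  and mult_poly6 [simp]: "f \<otimes>\<^bsub>poly6_ring :: 'a::field poly6 ring\<^esub> g = f * g"
  by (simp_all add: ring_of_type_algebra_def)

lemma pow_poly6 [simp]: "f [^]\<^bsub>poly6_ring :: 'a::field poly6 ring\<^esub> (n::nat) = f ^ n"
  by (induction n) (simp_all add: nat_pow_def mult.commute)

lemma uminus_poly6 [simp]: "\<ominus>\<^bsub>poly6_ring :: 'a::field poly6 ring\<^esub> f = - f"
proof -
  interpret cring "poly6_ring :: 'a poly6 ring" by (rule poly6_ring_cring)
  show ?thesis
    by (rule minus_equality) simp_all
qed

lemma finprod_poly6: "finite S \<Longrightarrow> finprod (poly6_ring :: 'a::field poly6 ring) f S = prod f S"
proof (induction S rule: finite_induct)
  case (insert i S)
  interpret cring "poly6_ring :: 'a poly6 ring" by (rule poly6_ring_cring)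
  show ?case using insert by simp
next
  case empty
  interpret cring "poly6_ring :: 'a poly6 ring" by (rule poly6_ring_cring)
  show ?case by simp
qed

section \<open>The ideal of minors inside the polynomial ring\<close>

abbreviation minors_power :: "nat \<Rightarrow> 'a::field poly6 set" where
  "minors_power t \<equiv> minors_ideal [^]\<^bsub>ideals_set poly6_ring\<^esub> t"

abbreviation minor1 :: "'a::field poly6" where "minor1 \<equiv> Var Iv * Var Iz - Var Iw * Var Iy"
abbreviation minor2 :: "'a::field poly6" where "minor2 \<equiv> Var Iw * Var Ix - Var Iu * Var Iz"
abbreviation minor3 :: "'a::field poly6" where "minor3 \<equiv> Var Iu * Var Iy - Var Iv * Var Ix"

lemma poly6_idealI:
  assumes "0 \<in> I" "\<And>f g. f \<in> I \<Longrightarrow> g \<in> I \<Longrightarrow> f + g \<in> I" "\<And>f g. g \<in> I \<Longrightarrow> f * g \<in> I"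
  shows "ideal I (poly6_ring :: 'a::field poly6 ring)"
proof -
  interpret cring "poly6_ring :: 'a poly6 ring" by (rule poly6_ring_cring)
  have neg: "- f \<in> I" if "f \<in> I" for f
    using assms(3)[OF that, of "-1"] by simp
  show ?thesis
  proof (rule idealI[OF ring_axioms])
    show "subgroup I (add_monoid (poly6_ring :: 'a poly6 ring))"
      using assms neg by (intro add.subgroupI) (auto simp flip: a_inv_def)
  qed (use assms in \<open>auto simp: mult.commute\<close>)
qed

lemma minors_ideal_ideal: "ideal (minors_ideal :: 'a::field poly6 set) poly6_ring"
  unfolding minors_ideal_def
  by (intro ring.genideal_ideal cring.axioms(1) poly6_ring_cring) simp

lemma minors_mem:
  "minor1 \<in> (minors_ideal :: 'a::field poly6 set)" "minor2 \<in> (minors_ideal :: 'a poly6 set)"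
  "minor3 \<in> (minors_ideal :: 'a poly6 set)"
proof -
  interpret cring "poly6_ring :: 'a poly6 ring" by (rule poly6_ring_cring)
  have "{minor1, minor2, minor3} \<subseteq> (minors_ideal :: 'a poly6 set)"
    unfolding minors_ideal_def by (rule genideal_self) simp
  then show "minor1 \<in> (minors_ideal :: 'a poly6 set)" "minor2 \<in> (minors_ideal :: 'a poly6 set)"
    "minor3 \<in> (minors_ideal :: 'a poly6 set)" by auto
qed

lemma minors_power_ideal: "ideal (minors_power t :: 'a::field poly6 set) poly6_ring"
  by (rule cring.ideal_pow_ideal[OF poly6_ring_cring minors_ideal_ideal])

lemma minors_power_zero: "0 \<in> minors_power t"
  using additive_subgroup.zero_closed[OF ideal.axioms(1)[OF minors_power_ideal]] by fastforce

lemma minors_power_mult: "f \<in> minors_power t \<Longrightarrow> g * f \<in> minors_power t"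
  using ideal.I_l_closed[OF minors_power_ideal] by fastforce

text \<open>Two different minors may occur: in the cocycle condition an \<open>r\<close>-th power
  comes from a change of column and a \<open>q\<close>-th power from
  \<open>minor_factor\<close>.\<close>

lemma minors_power_mult_mem:
  assumes "f \<in> minors_ideal" "g \<in> minors_ideal" "t \<le> m + n"
  shows "f ^ m * g ^ n \<in> minors_power t"
proof -
  interpret cring "poly6_ring :: 'a poly6 ring" by (rule poly6_ring_cring)
  have "f ^ m * g ^ n \<in> minors_power (m + n)"
    using ideal_pow_mult_mem[OF minors_ideal_ideal elem_pow_mem_ideal_pow[OF minors_ideal_ideal assms(1), of m]
        elem_pow_mem_ideal_pow[OF minors_ideal_ideal assms(2), of n]] by simp
  then show ?thesis
    using ideal_pow_antimono[OF minors_ideal_ideal assms(3)] by blast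
qed

section \<open>The specialisation w = z = 0\<close>

definition kill_wz :: "'a::field poly6 \<Rightarrow> 'a poly6" where
  "kill_wz = terms_satisfying (\<lambda>e. Poly_Mapping.lookup e Iw = 0 \<and> Poly_Mapping.lookup e Iz = 0)"

lemma kill_wz_0 [simp]: "kill_wz 0 = 0"
  by (simp add: kill_wz_def)

lemma kill_wz_1 [simp]: "kill_wz 1 = 1"
  by (simp add: kill_wz_def terms_satisfying_single flip: single_one)

lemma kill_wz_add: "kill_wz (f + g) = kill_wz f + kill_wz g"
  by (simp add: kill_wz_def terms_satisfying_add)

lemma kill_wz_diff: "kill_wz (f - g) = kill_wz f - kill_wz g"
  by (simp add: kill_wz_def terms_satisfying_diff)

lemma kill_wz_mult: "kill_wz (f * g) = kill_wz f * kill_wz g"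
  unfolding kill_wz_def by (rule terms_satisfying_mult) (auto simp: lookup_add)

lemma kill_wz_power: "kill_wz (f ^ n) = kill_wz f ^ n"
  by (induction n) (simp_all add: kill_wz_mult)

lemma kill_wz_Var: "kill_wz (Var i) = (if i = Iw \<or> i = Iz then 0 else Var i)"
  by (auto simp: kill_wz_def Var_def terms_satisfying_single lookup_single)

lemma kill_wz_Const: "kill_wz (Const c) = Const c"
  by (simp add: kill_wz_def Const_def terms_satisfying_single)

lemma kill_wz_uminus: "kill_wz (- f) = - kill_wz f"
  using kill_wz_diff[of 0 f] by simp

lemma kill_wz_sum: "kill_wz (sum f S) = (\<Sum>i\<in>S. kill_wz (f i))"
  by (induction S rule: infinite_finite_induct) (simp_all add: kill_wz_add)

text \<open>At \<open>w = z = 0\<close> the first two minors vanish and the third is unchanged. The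
  polynomials whose specialisation is divisible by \<open>minor3\<close> form an ideal, which thus
  contains all three generators.\<close>

lemma kill_wz_minors_ideal:
  assumes "f \<in> minors_ideal"
  shows "minor3 dvd kill_wz f"
proof -
  interpret cring "poly6_ring :: 'a poly6 ring" by (rule poly6_ring_cring)
  have "ideal {f :: 'a poly6. minor3 dvd kill_wz f} poly6_ring"
    by (rule poly6_idealI) (auto simp: kill_wz_add kill_wz_mult)
  then have "minors_ideal \<subseteq> {f :: 'a poly6. minor3 dvd kill_wz f}"
    unfolding minors_ideal_def
    by (rule genideal_minimal) (auto simp: kill_wz_diff kill_wz_mult kill_wz_Var)
  with assms show ?thesis by blast
qed

text \<open>The outer induction is on the exponent, the inner one on the generation of an ideal
  product by products and sums.\<close>

lemma kill_wz_minors_power: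
  assumes "f \<in> minors_power t"
  shows "minor3 ^ t dvd kill_wz f"
  using assms
proof (induction t arbitrary: f)
  case (Suc t)
  have "f \<in> ideal_prod poly6_ring (minors_power t) minors_ideal"
    using Suc.prems by (simp add: ideals_set_def)
  then show ?case
  proof (induction f)
    case (prod g h)
    then show ?case
      using mult_dvd_mono[OF Suc.IH[of g] kill_wz_minors_ideal[of h]]
      by (simp add: kill_wz_mult mult.commute)
  next
    case (sum g h)
    then show ?case by (simp add: kill_wz_add)
  qed
qed simp

section \<open>The graded Cech complex of a thickening\<close>

definition indets :: "'a::field poly6 list" where
  "indets = map Var [Iu, Iv, Iw, Ix, Iy, Iz]"

lemma length_indets [simp]: "length indets = 6"
  by (simp add: indets_def)

abbreviation residue :: "nat \<Rightarrow> 'a::field poly6 \<Rightarrow> 'a poly6 set" where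
  "residue t f \<equiv> minors_power t +>\<^bsub>poly6_ring\<^esub> f"

lemma Const_ring_hom: "Const \<in> ring_hom (ring_of_type_algebra :: 'a::field ring) poly6_ring"
  by (rule ring_hom_memI) (simp_all add: ring_of_type_algebra_def Const_def mult_single single_add)

lemma thickening_carrier: "carrier (thickening t) = range (residue t)"
  by (auto simp: thickening_def quotient_module_def FactRing_def A_RCOSETS_def')

lemma residue_closed [simp]: "residue t f \<in> carrier (thickening t)"
  by (simp add: thickening_carrier)

lemma thickening_module: "module poly6_ring (thickening t :: ('a::field poly6, _) module)"
  unfolding thickening_def by (rule quotient_module_module[OF poly6_ring_cring minors_power_ideal])

lemma thickening_add: "residue t f \<oplus>\<^bsub>thickening t\<^esub> residue t g = residue t (f + g)"
proof -
  interpret J: ideal "minors_power t :: 'a poly6 set" poly6_ring by (rule minors_power_ideal)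
  show ?thesis
    using J.a_rcos_sum[of f g] by (simp add: thickening_def quotient_module_def FactRing_def)
qed

lemma thickening_smult: "g \<odot>\<^bsub>thickening t\<^esub> residue t f = residue t (g * f)"
proof -
  interpret J: ideal "minors_power t :: 'a poly6 set" poly6_ring by (rule minors_power_ideal)
  show ?thesis
    using J.rcoset_mult_add[of g f] by (simp add: thickening_def quotient_module_def FactRing_def)
qed

lemma thickening_zero: "\<zero>\<^bsub>thickening t\<^esub> = residue t 0"
proof -
  interpret J: ideal "minors_power t :: 'a poly6 set" poly6_ring by (rule minors_power_ideal)
  show ?thesis
    using J.a_coset_join2[OF _ J.a_subgroup, of 0]
    by (simp add: minors_power_zero thickening_def quotient_module_def FactRing_def)
qed

lemma residue_eq_iff: "residue t f = residue t g \<longleftrightarrow> f - g \<in> minors_power t"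
proof -
  interpret J: ideal "minors_power t :: 'a poly6 set" poly6_ring by (rule minors_power_ideal)
  show ?thesis
    using J.quotient_eq_iff_same_a_r_cos[OF minors_power_ideal, of f g] by (simp add: a_minus_def)
qed

interpretation thickening: graded_cech_complex "poly6_ring :: 'a::field poly6 ring" "thickening t" indets
  "ring_of_type_algebra :: 'a ring" Const "thickening_piece t" for t
proof (intro graded_cech_complex.intro cech_complex.intro thickening_module
    cech_complex_axioms.intro graded_cech_complex_axioms.intro)
  show "set (indets :: 'a poly6 list) \<subseteq> carrier poly6_ring"
    by simp
  show "cring (ring_of_type_algebra :: 'a ring)"
    by (rule cring_from_type_algebra)
  show "Const \<in> ring_hom (ring_of_type_algebra :: 'a ring) poly6_ring"
    by (rule Const_ring_hom)
  show "thickening_piece t d \<subseteq> carrier (thickening t :: ('a poly6, _) module)" for d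
    by (auto simp: thickening_piece_def)
  show "\<zero>\<^bsub>thickening t\<^esub> \<in> (thickening_piece t d :: 'a poly6 set set)" for d
    using homogeneous_zero by (auto simp: thickening_piece_def thickening_zero)
  show "a \<oplus>\<^bsub>thickening t\<^esub> b \<in> thickening_piece t d"
    if "a \<in> thickening_piece t d" "b \<in> thickening_piece t d" for a b :: "'a poly6 set" and d
    using that by (auto simp: thickening_piece_def thickening_add intro!: imageI homogeneous_add)
  show "Const c \<odot>\<^bsub>thickening t\<^esub> a \<in> thickening_piece t d"
    if "a \<in> thickening_piece t d" for c :: 'a and a d
    using that homogeneous_mult[OF homogeneous_Const, of _ d c]
    by (auto simp: thickening_piece_def thickening_smult)
  show "f \<odot>\<^bsub>thickening t\<^esub> a \<in> thickening_piece t (d + 1)"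
    if f: "f \<in> set indets" and "a \<in> thickening_piece t d" for f :: "'a poly6" and a d
  proof -
    obtain i where "f = Var i" using f by (auto simp: indets_def)
    moreover have "Var i * g \<in> homogeneous (d + 1)" if "g \<in> homogeneous d" for g :: "'a poly6"
      using homogeneous_mult[OF homogeneous_Var that, of i] by (simp add: add.commute)
    ultimately show ?thesis
      using that(2) by (auto simp: thickening_piece_def thickening_smult intro!: imageI)
  qed
qed

lemma thickening_finsum:
  "finite S \<Longrightarrow> (\<Oplus>\<^bsub>thickening t\<^esub>i\<in>S. residue t (f i)) = residue t (\<Sum>i\<in>S. f i)"
  by (induction S rule: finite_induct)
    (simp_all add: thickening_zero thickening_add thickening.M.finsum_insert Pi_iff)

text \<open>Together with \<open>thickening_frac_eq_iff\<close> this turns statements about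
  coboundaries into congruences of polynomials modulo \<open>minors_power t\<close>.\<close>

lemma cech_diff_thickening:
  fixes f :: "nat set \<Rightarrow> 'a::field poly6"
  assumes T: "T \<in> cech_index (indets :: 'a poly6 list) (Suc k)"
    and c: "\<And>S. S \<in> cech_index (indets :: 'a poly6 list) k \<Longrightarrow>
      c S = frac poly6_ring (thickening t) (cech_prod poly6_ring indets S) (residue t (f S)) n"
  shows "cech_diff poly6_ring indets (thickening t) k c T =
    frac poly6_ring (thickening t) (cech_prod poly6_ring indets T)
      (residue t (\<Sum>i\<in>T. (- 1) ^ card {j \<in> T. j < i} * ((indets ! i) ^ n * f (T - {i})))) n"
  using thickening.cech_diff_frac[OF T, of "\<lambda>S. residue t (f S)" t c n] c
  by (simp add: thickening_smult thickening_finsum[OF thickening.cech_index_finite[OF T]])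

lemma thickening_frac_eq_iff:
  "frac poly6_ring (thickening t) f (residue t g) n = frac poly6_ring (thickening t) f (residue t h) m \<longleftrightarrow>
    (\<exists>i j. i + n = j + m \<and> f ^ i * g - f ^ j * h \<in> minors_power t)"
  by (simp add: thickening.frac_eq_iff thickening_smult residue_eq_iff)

lemma cech_prod_poly6: "finite T \<Longrightarrow> cech_prod poly6_ring fs T = (\<Prod>i\<in>T. fs ! i)"
  by (simp add: cech_prod_def finprod_poly6)

section \<open>The cocycles\<close>

text \<open>The positions \<open>0, 1, 2\<close> and \<open>3, 4, 5\<close> in \<^const>\<open>indets\<close> are the two rows of the matrix. At the set
  \<open>S = {k, l, m}\<close> the numerator below, over the \<open>2 q\<close>-th power of the product of the three
  indeterminates, gives \<open>\<Sum>\<^sub>i c\<^sub>i (x\<^sub>k / u\<^sub>k)\<^sup>i (\<plusminus> \<Delta>\<^sub>j\<^sup>q) / (x\<^sub>l x\<^sub>m)\<^sup>q\<close>.\<close>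

definition form_factor :: "nat \<Rightarrow> (nat \<Rightarrow> 'a::field) \<Rightarrow> nat set \<Rightarrow> 'a poly6" where
  "form_factor n c S =
     (if 0 \<in> S \<and> 1 \<notin> S \<and> 2 \<notin> S then binary_form n c (Var Iu) (Var Ix)
      else if 0 \<notin> S \<and> 1 \<in> S \<and> 2 \<notin> S then binary_form n c (Var Iv) (Var Iy)
      else if 0 \<notin> S \<and> 1 \<notin> S \<and> 2 \<in> S then binary_form n c (Var Iw) (Var Iz) else 0)"

text \<open>The negative sign in the middle case compensates for the alternating signs of the
  differential: the sum over the faces of \<open>{k, 3, 4, 5}\<close> becomes a multiple of the
  Frobenius relation between the minors.\<close>

definition minor_factor :: "nat \<Rightarrow> nat set \<Rightarrow> 'a::field poly6" where
  "minor_factor q S =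
     (if 3 \<notin> S \<and> 4 \<in> S \<and> 5 \<in> S then (Var Iy * Var Iz) ^ q * minor1 ^ q
      else if 3 \<in> S \<and> 4 \<notin> S \<and> 5 \<in> S then - ((Var Ix * Var Iz) ^ q * minor2 ^ q)
      else if 3 \<in> S \<and> 4 \<in> S \<and> 5 \<notin> S then (Var Ix * Var Iy) ^ q * minor3 ^ q else 0)"

definition cocycle_numerator :: "nat \<Rightarrow> (nat \<Rightarrow> 'a::field) \<Rightarrow> nat set \<Rightarrow> 'a poly6" where
  "cocycle_numerator q c S = form_factor (2 * q) c S * minor_factor q S"

text \<open>The sets are listed by the number of indices from the first row: one, two or three. The
  cocycle condition holds for a different reason in each of these cases.\<close>

lemma four_subsets:
  assumes "T \<subseteq> {..<6::nat}" "card T = 4"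
  shows "T \<in> {{0,3,4,5}, {1,3,4,5}, {2,3,4,5}, {0,1,3,4}, {0,1,3,5}, {0,1,4,5},
    {0,2,3,4}, {0,2,3,5}, {0,2,4,5}, {1,2,3,4}, {1,2,3,5}, {1,2,4,5}, {0,1,2,3}, {0,1,2,4}, {0,1,2,5}}"
proof -
  have "{..<6::nat} = set [0,1,2,3,4,5]" by auto
  with assms(1) have "T \<in> set ` set (subseqs [0,1,2,3,4,5])"
    by (simp only: subseqs_powset Pow_iff)
  then show ?thesis
    using assms(2) by (simp only: subseqs.simps Let_def list.map append.simps list.set image_insert image_empty insert_iff empty_iff)
      (elim disjE; simp)
qed

text \<open>In the product form the signs can be evaluated by simplification on explicit index
  sets.\<close>

lemma sign_eq_prod:
  assumes "finite T"
  shows "(- 1 :: 'a::comm_ring_1) ^ card {j \<in> T. j < (i::nat)} = (\<Prod>j\<in>T. if j < i then - 1 else 1)"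
  using assms by (simp add: prod.If_cases Collect_conj_eq Int_commute)

text \<open>If \<open>T\<close> has one index in the first row, the sum is a multiple of the
  Frobenius relation. With two, it is an antisymmetrized binary form times a \<open>q\<close>-th
  power of a minor, up to a factor. With three, all summands vanish.\<close>

lemma cocycle_numerator_mem:
  fixes c :: "nat \<Rightarrow> 'a::field"
  assumes p: "prime CHAR('a)" and q: "q = CHAR('a) ^ e" and r: "r = CHAR('a) ^ e'"
    and c: "\<And>i. c i \<noteq> 0 \<Longrightarrow> r dvd i" and t: "t \<le> q + r"
    and T: "T \<subseteq> {..<6}" "card T = 4"
  shows "(\<Sum>i\<in>T. (- 1) ^ card {j \<in> T. j < i} * ((indets ! i) ^ (2 * q) * cocycle_numerator q c (T - {i})))
    \<in> minors_power t"
proof -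
  define P1 P2 P3 where P: "P1 = binary_form (2 * q) c (Var Iu) (Var Ix)"
    "P2 = binary_form (2 * q) c (Var Iv) (Var Iy)" "P3 = binary_form (2 * q) c (Var Iw) (Var Iz)"
  define E1 E2 E3 :: "'a poly6" where E: "E1 = (Var Iy * Var Iz) ^ q * minor1 ^ q"
    "E2 = (Var Ix * Var Iz) ^ q * minor2 ^ q" "E3 = (Var Ix * Var Iy) ^ q * minor3 ^ q"
  have p': "prime CHAR('a poly6)" "q = CHAR('a poly6) ^ e"
    using p q by (simp_all add: CHAR_poly_mapping)
  \<comment> \<open>The expansion of a determinant with the row \<open>x, y, z\<close> repeated
    gives a linear relation between the minors, and Frobenius carries it to \<open>q\<close>-th
    powers.\<close>
  have "Var Ix ^ q * minor1 ^ q + Var Iy ^ q * minor2 ^ q + Var Iz ^ q * minor3 ^ q =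
      (Var Ix * minor1 + Var Iy * minor2 + Var Iz * minor3 :: 'a poly6) ^ q"
    using freshmans_dream'[OF p'] by (simp add: power_mult_distrib)
  also have "Var Ix * minor1 + Var Iy * minor2 + Var Iz * minor3 = (0 :: 'a poly6)"
    by (simp add: algebra_simps)
  finally have "Var Ix ^ q * minor1 ^ q + Var Iy ^ q * minor2 ^ q + Var Iz ^ q * minor3 ^ q = (0 :: 'a poly6)"
    using p q by (simp add: prime_gt_0_nat)
  then have "(Var Ix * Var Iy * Var Iz) ^ q *
      (Var Ix ^ q * minor1 ^ q + Var Iy ^ q * minor2 ^ q + Var Iz ^ q * minor3 ^ q) = (0 :: 'a poly6)"
    by (simp only: mult_zero_right)
  then have rel: "Var Ix ^ (2 * q) * E1 + Var Iy ^ (2 * q) * E2 + Var Iz ^ (2 * q) * E3 = 0"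
    unfolding E distrib_left power_mult_distrib mult_2 power_add by (simp only: ac_simps)
  \<comment> \<open>The change of column contributes the \<open>r\<close>-th power of a minor and
    \<open>g\<close> contains the \<open>q\<close>-th power of a minor, while
    \<open>t \<le> q + r\<close>.\<close>
  have mem: "(b ^ (2 * q) * binary_form (2 * q) c a d - a ^ (2 * q) * binary_form (2 * q) c b f) * g
      \<in> minors_power t"
    if minor: "b * d - a * f \<in> minors_ideal" and gE: "g \<in> {E1, E2, E3}" for a b d f g
  proof -
    obtain h m :: "'a poly6" where g: "g = h * m ^ q" "m \<in> minors_ideal"
    proof -
      from gE consider "g = E1" | "g = E2" | "g = E3" by blast
      then show thesis
        using that minors_mem unfolding E by cases blast+
    qed
    obtain k where k: "b ^ (2 * q) * binary_form (2 * q) c a d - a ^ (2 * q) * binary_form (2 * q) c b f =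
        (b * d - a * f) ^ r * k"
      using binary_form_antisymmetrized_dvd[OF p r c] by (rule dvdE)
    have "(k * h) * ((b * d - a * f) ^ r * m ^ q) \<in> minors_power t"
      using t by (intro minors_power_mult minors_power_mult_mem minor g(2)) simp
    then show ?thesis
      unfolding k g by (simp only: ac_simps)
  qed
  have neg: "- f \<in> minors_ideal" if "f \<in> minors_ideal" for f :: "'a poly6"
    using ideal.I_l_closed[OF minors_ideal_ideal that, of "- 1"] by simp
  \<comment> \<open>Both orders are recorded, since the negative sign in front of \<open>E2\<close>
    reverses the difference.\<close>
  have uv: "Var Iv ^ (2 * q) * (P1 * g) - Var Iu ^ (2 * q) * (P2 * g) \<in> minors_power t"
    "Var Iu ^ (2 * q) * (P2 * g) - Var Iv ^ (2 * q) * (P1 * g) \<in> minors_power t"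
    if "g \<in> {E1, E2, E3}" for g
    unfolding P mult.assoc[symmetric] left_diff_distrib[symmetric]
    using neg[OF minors_mem(3)] minors_mem(3) by (intro mem that; simp add: algebra_simps)+
  have uw: "Var Iw ^ (2 * q) * (P1 * g) - Var Iu ^ (2 * q) * (P3 * g) \<in> minors_power t"
    "Var Iu ^ (2 * q) * (P3 * g) - Var Iw ^ (2 * q) * (P1 * g) \<in> minors_power t"
    if "g \<in> {E1, E2, E3}" for g
    unfolding P mult.assoc[symmetric] left_diff_distrib[symmetric]
    using neg[OF minors_mem(2)] minors_mem(2) by (intro mem that; simp add: algebra_simps)+
  have vw: "Var Iw ^ (2 * q) * (P2 * g) - Var Iv ^ (2 * q) * (P3 * g) \<in> minors_power t"
    "Var Iv ^ (2 * q) * (P3 * g) - Var Iw ^ (2 * q) * (P2 * g) \<in> minors_power t"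
    if "g \<in> {E1, E2, E3}" for g
    unfolding P mult.assoc[symmetric] left_diff_distrib[symmetric]
    using neg[OF minors_mem(1)] minors_mem(1) by (intro mem that; simp add: algebra_simps)+
  \<comment> \<open>The relation is solved for one term so that it can be used for
    rewriting.\<close>
  have rel': "Var Ix ^ (2 * q) * (g * E1) = - (Var Iy ^ (2 * q) * (g * E2)) - Var Iz ^ (2 * q) * (g * E3)" for g
  proof -
    have "g * (Var Ix ^ (2 * q) * E1 + Var Iy ^ (2 * q) * E2 + Var Iz ^ (2 * q) * E3) = 0"
      using rel by simp
    then show ?thesis
      by (simp only: distrib_left ac_simps) (simp add: algebra_simps eq_neg_iff_add_eq_0)
  qed
  have num: "cocycle_numerator q c S =
     (if 0 \<in> S \<and> 1 \<notin> S \<and> 2 \<notin> S then P1 else if 0 \<notin> S \<and> 1 \<in> S \<and> 2 \<notin> S then P2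
      else if 0 \<notin> S \<and> 1 \<notin> S \<and> 2 \<in> S then P3 else 0) *
     (if 3 \<notin> S \<and> 4 \<in> S \<and> 5 \<in> S then E1 else if 3 \<in> S \<and> 4 \<notin> S \<and> 5 \<in> S then - E2
      else if 3 \<in> S \<and> 4 \<in> S \<and> 5 \<notin> S then E3 else 0)" for S
    unfolding cocycle_numerator_def form_factor_def minor_factor_def P E by (rule refl)
  have "finite T"
    using T(1) by (rule finite_subset) simp
  show ?thesis
    unfolding sign_eq_prod[OF \<open>finite T\<close>]
    using four_subsets[OF T] unfolding insert_iff empty_iff
    by (elim disjE; simp add: indets_def num uv uw vw rel' minors_power_zero)
qed

text \<open>For arbitrary \<open>c\<close> this is only a cochain. It becomes a cocycle when the
  support of \<open>c\<close> consists of multiples of a suitable power of the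
  characteristic.\<close>

definition cocycle :: "nat \<Rightarrow> nat \<Rightarrow> (nat \<Rightarrow> 'a::field) \<Rightarrow> nat set \<Rightarrow> ('a poly6 set \<times> nat) set" where
  "cocycle t q c = (\<lambda>S\<in>cech_index (indets :: 'a poly6 list) 3. frac poly6_ring (thickening t)
     (cech_prod poly6_ring indets S) (residue t (cocycle_numerator q c S)) (2 * q))"

lemma cocycle_closed: "cocycle t q c \<in> carrier (cech poly6_ring indets (thickening t) 3)"
  by (auto simp: cocycle_def cech_def cech_loc_def thickening.frac_closed)

lemma cocycle_numerator_add:
  "cocycle_numerator q (\<lambda>i. c i + c' i) S = cocycle_numerator q c S + cocycle_numerator q c' S"
  by (simp add: cocycle_numerator_def form_factor_def binary_form_add distrib_right)

lemma cocycle_numerator_scale: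
  "cocycle_numerator q (\<lambda>i. k * c i) S = Const k * cocycle_numerator q c S"
  by (simp add: cocycle_numerator_def form_factor_def binary_form_scale mult.assoc)

text \<open>With \<open>cocycle_scale\<close> this gives linearity in \<open>c\<close>, so a linear
  combination of the classes again belongs to a single coefficient sequence.\<close>

lemma cocycle_add:
  "cocycle t q (\<lambda>i. c i + c' i) =
    cocycle t q c \<oplus>\<^bsub>cech poly6_ring indets (thickening t) 3\<^esub> cocycle t q (c' :: nat \<Rightarrow> 'a::field)"
proof (rule thickening.cech_eqI[where k = 3])
  interpret C: module poly6_ring "cech poly6_ring (indets :: 'a poly6 list) (thickening t) 3"
    by (rule thickening.cech_module)
  show "cocycle t q (\<lambda>i. c i + c' i) \<in> carrier (cech poly6_ring indets (thickening t) 3)"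
    by (rule cocycle_closed)
  show "cocycle t q c \<oplus>\<^bsub>cech poly6_ring indets (thickening t) 3\<^esub> cocycle t q c' \<in>
      carrier (cech poly6_ring indets (thickening t) 3)"
    by (intro C.M.a_closed cocycle_closed)
qed (auto simp: cocycle_closed thickening.cech_add_component cocycle_def cech_loc_def
    thickening.localisation_add_same thickening_add cocycle_numerator_add)

lemma cocycle_scale:
  "cocycle t q (\<lambda>i. k * c i) =
    Const k \<odot>\<^bsub>cech poly6_ring indets (thickening t) 3\<^esub> cocycle t q (c :: nat \<Rightarrow> 'a::field)"
proof (rule thickening.cech_eqI[where k = 3])
  interpret C: module poly6_ring "cech poly6_ring (indets :: 'a poly6 list) (thickening t) 3"
    by (rule thickening.cech_module)
  show "cocycle t q (\<lambda>i. k * c i) \<in> carrier (cech poly6_ring indets (thickening t) 3)"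
    by (rule cocycle_closed)
  show "Const k \<odot>\<^bsub>cech poly6_ring indets (thickening t) 3\<^esub> cocycle t q c \<in>
      carrier (cech poly6_ring indets (thickening t) 3)"
    by (intro C.smult_closed cocycle_closed) simp
qed (auto simp: cocycle_closed thickening.cech_smult_component cocycle_def cech_loc_def
    thickening.localisation_smult thickening_smult cocycle_numerator_scale)

text \<open>A fraction with numerator in \<open>minors_power t\<close> is zero, so the claim reduces
  to \<open>cocycle_numerator_mem\<close>.\<close>

lemma cocycle_mem_cocycles:
  fixes c :: "nat \<Rightarrow> 'a::field"
  assumes p: "prime CHAR('a)" "q = CHAR('a) ^ e" "r = CHAR('a) ^ e'"
    and c: "\<And>i. c i \<noteq> 0 \<Longrightarrow> r dvd i" and t: "t \<le> q + r"
  shows "cocycle t q c \<in> cech_cocycles poly6_ring indets (thickening t) 3"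
proof -
  interpret C: module poly6_ring "cech poly6_ring (indets :: 'a poly6 list) (thickening t) (Suc 3)"
    by (rule thickening.cech_module)
  have "cech_diff poly6_ring indets (thickening t) 3 (cocycle t q c) =
      \<zero>\<^bsub>cech poly6_ring indets (thickening t) (Suc 3)\<^esub>"
  proof (rule thickening.cech_eqI[where k = "Suc 3"])
    show "cech_diff poly6_ring indets (thickening t) 3 (cocycle t q c) \<in>
        carrier (cech poly6_ring indets (thickening t) (Suc 3))"
      by (intro thickening.cech_diff_closed cocycle_closed)
    show "\<zero>\<^bsub>cech poly6_ring indets (thickening t) (Suc 3)\<^esub> \<in>
        carrier (cech poly6_ring (indets :: 'a poly6 list) (thickening t) (Suc 3))"
      by (rule C.M.zero_closed)
    fix T assume T: "T \<in> cech_index (indets :: 'a poly6 list) (Suc 3)"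
    let ?s = "\<Sum>i\<in>T. (- 1) ^ card {j \<in> T. j < i} * ((indets ! i) ^ (2 * q) * cocycle_numerator q c (T - {i}))"
    have "cech_diff poly6_ring indets (thickening t) 3 (cocycle t q c) T =
        frac poly6_ring (thickening t) (cech_prod poly6_ring indets T) (residue t ?s) (2 * q)"
      by (rule cech_diff_thickening[OF T]) (simp only: cocycle_def restrict_apply if_True)
    also have "residue t ?s = residue t 0"
      unfolding residue_eq_iff diff_0_right
      using T by (intro cocycle_numerator_mem[OF p c t]) (auto simp: cech_index_def)
    finally show "cech_diff poly6_ring indets (thickening t) 3 (cocycle t q c) T =
        \<zero>\<^bsub>cech poly6_ring indets (thickening t) (Suc 3)\<^esub> T"
      using thickening.frac_zero[OF thickening.cech_prod_closed[OF T], of t "2 * q"]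
      by (simp only: thickening.cech_zero_component[OF T] cech_loc_def thickening_zero)
  qed
  then show ?thesis
    by (simp add: cech_cocycles_def cocycle_closed)
qed

lemma homogeneous_minors: "minor1 \<in> homogeneous 2" "minor2 \<in> homogeneous 2" "minor3 \<in> homogeneous 2"
  using homogeneous_mult[OF homogeneous_Var homogeneous_Var] by (auto intro!: homogeneous_diff)

lemma homogeneous_binary_form:
  assumes "a \<in> homogeneous 1" "b \<in> homogeneous 1"
  shows "binary_form n c a b \<in> homogeneous (int n)"
  unfolding binary_form_def
proof (rule homogeneous_sum)
  fix i assume "i \<in> {..<n}"
  then have "0 + int (n - i) * 1 + int i * 1 = int n" by simp
  then show "Const (c i) * a ^ (n - i) * b ^ i \<in> homogeneous (int n)"
    using assms by (metis homogeneous_mult homogeneous_power homogeneous_Const)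
qed

text \<open>The form factor has degree \<open>2 * q\<close> and the minor factor
  \<open>4 * q\<close>. The total is the degree of the denominator, a \<open>2 * q\<close>-th power
  of a product of three indeterminates, so the fractions have degree 0.\<close>

lemma homogeneous_cocycle_numerator: "cocycle_numerator q c S \<in> homogeneous (int (2 * q) * 3)"
proof -
  have "form_factor n c S \<in> homogeneous (int n)" for n
    by (auto simp: form_factor_def intro!: homogeneous_binary_form homogeneous_Var homogeneous_zero)
  moreover have "(Var i * Var j) ^ q * m ^ q \<in> homogeneous (int (4 * q))" if "m \<in> homogeneous 2" for i j m
  proof -
    have "(Var i * Var j) ^ q \<in> homogeneous (int q * (1 + 1))"
      by (intro homogeneous_power homogeneous_mult homogeneous_Var)
    from homogeneous_mult[OF this homogeneous_power[OF that, of q]] show ?thesis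
      by (simp add: algebra_simps)
  qed
  then have "minor_factor q S \<in> homogeneous (int (4 * q))"
    using homogeneous_minors
    by (auto simp: minor_factor_def intro!: homogeneous_uminus homogeneous_zero)
  ultimately have "form_factor (2 * q) c S * minor_factor q S \<in> homogeneous (int (2 * q) + int (4 * q))"
    by (intro homogeneous_mult)
  then show ?thesis
    by (simp add: cocycle_numerator_def algebra_simps)
qed

lemma cocycle_mem_piece:
  "cocycle t q c \<in> cech_piece poly6_ring indets (thickening t) (thickening_piece t) 3 0"
proof (rule thickening.cech_pieceI[OF cocycle_closed])
  fix S assume S: "S \<in> cech_index (indets :: 'a poly6 list) 3"
  then have "residue t (cocycle_numerator q c S) \<in> thickening_piece t (0 + int (2 * q) * int (card S))"
    using homogeneous_cocycle_numerator[of q c S]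
    by (auto simp: thickening_piece_def cech_index_def intro!: imageI)
  with S show "\<exists>a n. cocycle t q c S = frac poly6_ring (thickening t) (cech_prod poly6_ring indets S) a n \<and>
      a \<in> thickening_piece t (0 + int n * int (card S))"
    by (intro exI[of _ "residue t (cocycle_numerator q c S)"] exI[of _ "2 * q"]) (simp add: cocycle_def)
qed

section \<open>Independence of the classes and the rank bound\<close>

text \<open>A cochain with the given coboundary is specialised to \<open>w = z = 0\<close>. An
  alternating sum over the triples from \<open>u, v, x, y\<close>, an explicit form of the
  connecting homomorphism, leads to the equation in \<open>binary_form_coeff_eq_0\<close>.\<close>

lemma cocycle_coboundary_coeff:
  fixes c :: "nat \<Rightarrow> 'a::field"
  assumes B: "cocycle t q c \<in> cech_coboundaries poly6_ring indets (thickening t) 3"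
    and t: "q < t" and i: "0 < i" "i < 2 * q"
  shows "c i = 0"
proof -
  let ?J = "minors_power t :: 'a poly6 set"
  let ?f = "cech_prod (poly6_ring :: 'a poly6 ring) indets"
  have three: "(3::nat) = Suc 2" by simp
  from B obtain y where y: "y \<in> carrier (cech poly6_ring (indets :: 'a poly6 list) (thickening t) 2)"
    and yB: "cocycle t q c = cech_diff poly6_ring indets (thickening t) 2 y"
    unfolding three thickening.cech_coboundaries_Suc by blast
  obtain a' n where a': "\<And>S. S \<in> cech_index (indets :: 'a poly6 list) 2 \<Longrightarrow> a' S \<in> carrier (thickening t)"
    and y_eq': "\<And>S. S \<in> cech_index (indets :: 'a poly6 list) 2 \<Longrightarrow> y S = frac poly6_ring (thickening t) (?f S) (a' S) n"
    using thickening.cech_common_denominator[OF y] by blast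
  have "\<exists>b. a' S = residue t b" if "S \<in> cech_index (indets :: 'a poly6 list) 2" for S
    using a'[OF that] by (auto simp: thickening_carrier)
  then obtain a where a: "\<And>S. S \<in> cech_index (indets :: 'a poly6 list) 2 \<Longrightarrow> a' S = residue t (a S)"
    by metis
  have y_eq: "y S = frac poly6_ring (thickening t) (?f S) (residue t (a S)) n"
    if "S \<in> cech_index (indets :: 'a poly6 list) 2" for S
    using y_eq'[OF that] a[OF that] by simp
  define b where "b T = (\<Sum>i\<in>T. (- 1) ^ card {j \<in> T. j < i} * ((indets ! i) ^ n * a (T - {i})))" for T
  have "\<exists>k l. k + 2 * q = l + n \<and> ?f T ^ k * cocycle_numerator q c T - ?f T ^ l * b T \<in> ?J"
    if T: "T \<in> cech_index (indets :: 'a poly6 list) 3" for T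
  proof -
    have "frac poly6_ring (thickening t) (?f T) (residue t (cocycle_numerator q c T)) (2 * q) = cocycle t q c T"
      using T by (simp add: cocycle_def)
    also have "\<dots> = frac poly6_ring (thickening t) (?f T) (residue t (b T)) n"
      unfolding yB b_def using T y_eq by (intro cech_diff_thickening) simp_all
    finally show ?thesis
      by (simp add: thickening_frac_eq_iff)
  qed
  then obtain k l where kl: "\<And>T. T \<in> cech_index (indets :: 'a poly6 list) 3 \<Longrightarrow> k T + 2 * q = l T + n"
    "\<And>T. T \<in> cech_index (indets :: 'a poly6 list) 3 \<Longrightarrow>
      ?f T ^ k T * cocycle_numerator q c T - ?f T ^ l T * b T \<in> ?J"
    by metis
  \<comment> \<open>A common bound for the exponents \<open>k T\<close>, so that all four
    congruences can be multiplied up to the same powers \<open>K + n\<close> and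
    \<open>K + 2 * q\<close>.\<close>
  define K where "K = k {0,1,3} + k {0,1,4} + k {0,3,4} + k {1,3,4}"
  \<comment> \<open>These are the triples from \<open>u, v, x, y\<close>. In their alternating sum the coboundary cancels.\<close>
  have dvd: "minor3 ^ t dvd kill_wz (?f T) ^ (K + n) * kill_wz (cocycle_numerator q c T) -
      kill_wz (?f T) ^ (K + 2 * q) * kill_wz (b T)"
    if T: "T \<in> {{0,1,3}, {0,1,4}, {0,3,4}, {1,3,4}}" for T
  proof -
    have idx: "T \<in> cech_index (indets :: 'a poly6 list) 3"
      using T by (auto simp: cech_index_def)
    have "k T \<le> K"
      using T by (auto simp: K_def)
    define m where "m = K + n - k T"
    with \<open>k T \<le> K\<close> have e: "K + n = m + k T" "K + 2 * q = m + l T"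
      using kl(1)[OF idx] by simp_all
    have "?f T ^ m * (?f T ^ k T * cocycle_numerator q c T - ?f T ^ l T * b T) \<in> ?J"
      using kl(2)[OF idx] by (rule minors_power_mult)
    also have "?f T ^ m * (?f T ^ k T * cocycle_numerator q c T - ?f T ^ l T * b T) =
        ?f T ^ (K + n) * cocycle_numerator q c T - ?f T ^ (K + 2 * q) * b T"
      unfolding e power_add by (simp only: right_diff_distrib mult.assoc)
    finally show ?thesis
      by (auto dest!: kill_wz_minors_power simp: kill_wz_diff kill_wz_mult kill_wz_power)
  qed
  define \<alpha> where "\<alpha> S = kill_wz (a S)" for S
  let ?u = "Var Iu :: 'a poly6" and ?v = "Var Iv :: 'a poly6"
    and ?x = "Var Ix :: 'a poly6" and ?y = "Var Iy :: 'a poly6"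
  let ?D = "minor3 :: 'a poly6"
  define P where "P = binary_form (2 * q) c ?u ?x"
  define P' where "P' = binary_form (2 * q) c ?v ?y"
  have kill_form: "kill_wz (binary_form m c (Var i) (Var j)) = binary_form m c (Var i) (Var j)"
    if "i \<in> {Iu, Iv}" "j \<in> {Ix, Iy}" for m i j
    using that by (auto simp: binary_form_def kill_wz_sum kill_wz_mult kill_wz_power kill_wz_Const kill_wz_Var)
  have f: "kill_wz (?f {0,1,3}) = ?u * ?v * ?x" "kill_wz (?f {0,1,4}) = ?u * ?v * ?y"
    "kill_wz (?f {0,3,4}) = ?u * ?x * ?y" "kill_wz (?f {1,3,4}) = ?v * ?x * ?y"
    by (simp_all add: cech_prod_poly6 indets_def kill_wz_mult kill_wz_Var mult.assoc)
  \<comment> \<open>The first two triples contain both \<open>u\<close> and \<open>v\<close>, where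
    \<open>form_factor\<close> is zero, so only the coboundary remains in their congruences.\<close>
  have num: "kill_wz (cocycle_numerator q c {0,1,3}) = 0" "kill_wz (cocycle_numerator q c {0,1,4}) = 0"
    "kill_wz (cocycle_numerator q c {0,3,4}) = P * ((?x * ?y) ^ q * ?D ^ q)"
    "kill_wz (cocycle_numerator q c {1,3,4}) = P' * ((?x * ?y) ^ q * ?D ^ q)"
    by (simp_all add: cocycle_numerator_def form_factor_def minor_factor_def kill_wz_mult kill_wz_power
        kill_wz_diff kill_wz_Var kill_form P_def P'_def)
  have kb_eq: "kill_wz (b T) = (\<Sum>i\<in>T. (\<Prod>j\<in>T. if j < i then - 1 else 1) *
      (kill_wz (indets ! i) ^ n * \<alpha> (T - {i})))" if "finite T" for T
    unfolding sign_eq_prod[OF that, symmetric]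
    by (simp add: b_def \<alpha>_def kill_wz_sum kill_wz_mult kill_wz_power kill_wz_uminus)
  have kb: "kill_wz (b {0,1,3}) = ?u ^ n * \<alpha> {1,3} - ?v ^ n * \<alpha> {0,3} + ?x ^ n * \<alpha> {0,1}"
    "kill_wz (b {0,1,4}) = ?u ^ n * \<alpha> {1,4} - ?v ^ n * \<alpha> {0,4} + ?y ^ n * \<alpha> {0,1}"
    "kill_wz (b {0,3,4}) = ?u ^ n * \<alpha> {3,4} - ?x ^ n * \<alpha> {0,4} + ?y ^ n * \<alpha> {0,3}"
    "kill_wz (b {1,3,4}) = ?v ^ n * \<alpha> {3,4} - ?x ^ n * \<alpha> {1,4} + ?y ^ n * \<alpha> {1,3}"
    by (simp_all add: kb_eq indets_def kill_wz_Var insert_Diff_if)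
  obtain g1 where g1: "(?u * ?v * ?x) ^ (K + 2 * q) * kill_wz (b {0,1,3}) = ?D ^ t * g1"
    using dvd[of "{0,1,3}"] unfolding f num by auto
  obtain g2 where g2: "(?u * ?v * ?y) ^ (K + 2 * q) * kill_wz (b {0,1,4}) = ?D ^ t * g2"
    using dvd[of "{0,1,4}"] unfolding f num by auto
  obtain g3 where g3: "(?u * ?x * ?y) ^ (K + n) * (P * ((?x * ?y) ^ q * ?D ^ q)) -
      (?u * ?x * ?y) ^ (K + 2 * q) * kill_wz (b {0,3,4}) = ?D ^ t * g3"
    using dvd[of "{0,3,4}"] unfolding f num by auto
  obtain g4 where g4: "(?v * ?x * ?y) ^ (K + n) * (P' * ((?x * ?y) ^ q * ?D ^ q)) -
      (?v * ?x * ?y) ^ (K + 2 * q) * kill_wz (b {1,3,4}) = ?D ^ t * g4"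
    using dvd[of "{1,3,4}"] unfolding f num by auto
  let ?w = "?u * ?v * ?x * ?y" and ?N = "K + n"
  have pw: "(s * s') ^ m = s ^ m * s' ^ m" "s ^ (m + m') = s ^ m * s ^ m'" for s s' :: "'a poly6" and m m'
    by (simp_all add: power_mult_distrib power_add)
  \<comment> \<open>Each congruence is multiplied by the power \<open>?N + 2 * q\<close> of the
    indeterminate missing from its triple. With these signs the terms in \<open>\<alpha>\<close>
    cancel in pairs.\<close>
  have "?w ^ ?N * (?v ^ (2 * q) * P - ?u ^ (2 * q) * P') * (?x * ?y) ^ q * ?D ^ q =
      ?v ^ (?N + 2 * q) * ((?u * ?x * ?y) ^ (K + n) * (P * ((?x * ?y) ^ q * ?D ^ q)) -
        (?u * ?x * ?y) ^ (K + 2 * q) * kill_wz (b {0,3,4})) -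
      ?u ^ (?N + 2 * q) * ((?v * ?x * ?y) ^ (K + n) * (P' * ((?x * ?y) ^ q * ?D ^ q)) -
        (?v * ?x * ?y) ^ (K + 2 * q) * kill_wz (b {1,3,4})) -
      ?y ^ (?N + 2 * q) * ((?u * ?v * ?x) ^ (K + 2 * q) * kill_wz (b {0,1,3})) +
      ?x ^ (?N + 2 * q) * ((?u * ?v * ?y) ^ (K + 2 * q) * kill_wz (b {0,1,4}))"
    unfolding kb pw by (simp add: algebra_simps)
  also have "\<dots> = ?D ^ t * (?u ^ (?N + 2 * q) * - g4 + ?v ^ (?N + 2 * q) * g3 +
      ?x ^ (?N + 2 * q) * g2 + ?y ^ (?N + 2 * q) * - g1)"
    unfolding g1 g2 g3 g4 by (simp add: algebra_simps)
  finally show ?thesis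
    unfolding P_def P'_def using t i by (rule binary_form_coeff_eq_0)
qed

text \<open>The first \<open>2 * (q div r) - 1\<close> positive multiples of \<open>r\<close> lie
  below \<open>2 * q\<close>, and each gives a class. These are independent: the class is linear in
  the coefficients, and it vanishes only if all coefficients strictly between 0 and
  \<open>2 * q\<close> do.\<close>

lemma vs_rank_H_thickening_ge:
  assumes p: "prime CHAR('a)" "q = CHAR('a) ^ e" "r = CHAR('a) ^ e'"
    and t: "q < t" "t \<le> q + r"
  shows "enat (2 * (q div r) - 1) \<le> vs_rank ring_of_type_algebra (H_thickening 3 t 0 :: ('a::field, _) module)"
proof -
  let ?F = "ring_of_type_algebra :: 'a ring" and ?n = "2 * (q div r) - 1"
  let ?H = "local_cohomology poly6_ring (indets :: 'a poly6 list) (thickening t) 3"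
  let ?V = "H_thickening 3 t 0 :: ('a, _) module"
  let ?C = "cech poly6_ring (indets :: 'a poly6 list) (thickening t) 3"
  let ?B = "cech_coboundaries poly6_ring (indets :: 'a poly6 list) (thickening t) 3"
  have V_def: "?V = restrict_scalars Const ?H
      (local_cohomology_piece poly6_ring indets (thickening t) (thickening_piece t) 3 0)"
    by (simp add: H_thickening_def indets_def Let_def)
  have "module ?F ?V"
    using thickening.local_cohomology_piece_module[of t 2 0] by (simp add: V_def)
  then interpret V: vectorspace ?F ?V
    by (intro vectorspace.intro field_from_type_algebra)
  define L where "L c = ?B +>\<^bsub>?C\<^esub> cocycle t q c" for c :: "nat \<Rightarrow> 'a"
  have r: "r > 0"
    using p by (simp add: prime_gt_0_nat)
  have L_closed: "L c \<in> carrier ?V" if "\<And>i. c i \<noteq> 0 \<Longrightarrow> r dvd i" for c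
    using cocycle_mem_cocycles[OF p that t(2)] cocycle_mem_piece[of t q c]
    by (auto simp: V_def restrict_scalars_def local_cohomology_piece_def L_def)
  have L_add: "L (\<lambda>i. c i + c' i) = L c \<oplus>\<^bsub>?V\<^esub> L c'" for c c'
    using thickening.coset_add[of "cocycle t q c" t 2 "cocycle t q c'"]
    by (simp add: cocycle_closed L_def cocycle_add V_def restrict_scalars_def)
  have L_scale: "L (\<lambda>i. k * c i) = k \<odot>\<^bsub>?V\<^esub> L c" for k c
    using thickening.coset_smult[of "cocycle t q c" t 2 "Const k"]
    by (simp add: cocycle_closed L_def cocycle_scale V_def restrict_scalars_def)
  have L_eq_0: "c i = 0" if "L c = \<zero>\<^bsub>?V\<^esub>" "0 < i" "i < 2 * q" for c i
    using that cocycle_coboundary_coeff[OF _ t(1) that(2,3), of c]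
      thickening.coset_eq_zeroD[of "cocycle t q c" t 2]
    by (simp add: cocycle_closed L_def V_def restrict_scalars_def)
  \<comment> \<open>The shift to \<open>Suc i\<close> avoids the exponent 0, which
    \<open>L_eq_0\<close> does not control.\<close>
  define v where "v i = L (\<lambda>j. if j = r * Suc i then 1 else 0)" for i
  have v: "v i \<in> carrier ?V" for i
    unfolding v_def by (rule L_closed) (auto split: if_splits)
  have L_0: "L (\<lambda>_. 0) = \<zero>\<^bsub>?V\<^esub>"
  proof -
    have "L (\<lambda>_. 0) = 0 \<odot>\<^bsub>?V\<^esub> v 0"
      using L_scale[of 0 "\<lambda>j. if j = r * Suc 0 then 1 else 0"] by (simp add: v_def)
    then show ?thesis
      using V.smult_l_null[OF v] by (simp add: ring_of_type_algebra_def)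
  qed
  show ?thesis
  proof (rule vs_rank_geI)
    show "vectorspace ?F ?V" by (rule V.vectorspace_axioms)
    fix i assume "i < ?n"
    show "v i \<in> carrier ?V" by (rule v)
  next
    fix a and i assume sum0: "(\<Oplus>\<^bsub>?V\<^esub>i\<in>{..<?n}. a i \<odot>\<^bsub>?V\<^esub> v i) = \<zero>\<^bsub>?V\<^esub>" and i: "i < ?n"
    \<comment> \<open>By linearity of \<open>L\<close> the combination is the class of a single
      coefficient sequence, to which \<open>L_eq_0\<close> applies.\<close>
    have "(\<Oplus>\<^bsub>?V\<^esub>i\<in>{..<m}. a i \<odot>\<^bsub>?V\<^esub> v i) = L (\<lambda>j. \<Sum>i<m. if j = r * Suc i then a i else 0)" for m
    proof (induction m)
      case 0
      then show ?case by (simp add: L_0)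
    next
      case (Suc m)
      have "a m \<odot>\<^bsub>?V\<^esub> v m = L (\<lambda>j. if j = r * Suc m then a m else 0)"
        unfolding v_def L_scale[symmetric] by (rule arg_cong[of _ _ L]) auto
      moreover have "(\<lambda>i. a i \<odot>\<^bsub>?V\<^esub> v i) \<in> {..<m} \<rightarrow> carrier ?V" "a m \<odot>\<^bsub>?V\<^esub> v m \<in> carrier ?V"
        using v by (auto simp: ring_of_type_algebra_def)
      ultimately show ?case
        using Suc by (simp add: lessThan_Suc V.M.finsum_insert V.M.a_comm flip: L_add)
    qed
    with sum0 have "L (\<lambda>j. \<Sum>i<?n. if j = r * Suc i then a i else 0) = \<zero>\<^bsub>?V\<^esub>" by simp
    moreover have "r * Suc i < 2 * q"
    proof -
      have "r * Suc i \<le> r * (2 * (q div r) - 1)"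
        using i by (intro mult_left_mono) auto
      also have "\<dots> < r * (2 * (q div r))"
        using i r by (intro mult_strict_left_mono) auto
      also have "\<dots> \<le> 2 * q"
        by (simp add: mult.left_commute[of r 2])
      finally show ?thesis .
    qed
    ultimately have "(\<Sum>i'<?n. if r * Suc i = r * Suc i' then a i' else 0) = 0"
      using r by (intro L_eq_0[of _ "r * Suc i"]) simp_all
    then show "a i = \<zero>\<^bsub>?F\<^esub>"
      using i r by (simp add: ring_of_type_algebra_def)
  qed
qed

theorem theorem5p1:
  fixes p t q q2 :: nat and F :: "'a::field ring"
  assumes "F = ring_of_type_algebra"
    and "prime p"
    and "CHAR('a) = p"
    and "t \<ge> 2"
    and "q = (GREATEST n. (\<exists>i. n = p ^ i) \<and> n \<le> t - 1)"
    and "q2 = (LEAST n. (\<exists>i. n = p ^ i) \<and> q + n \<ge> t)"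
  shows "(\<forall>m. 0 < m \<and> m \<le> q \<and> q2 dvd m \<longrightarrow>
            vs_rank F (H_thickening 3 t 0) \<ge> enat (2 * (q div q2) - 1)) \<and>
         (\<forall>e. t = p ^ e + 1 \<longrightarrow>
            vs_rank F (H_thickening 3 t 0) \<ge> enat (2 * t - 3))"
proof -
  have p: "prime CHAR('a)" "1 < p"
    using assms(2,3) prime_gt_1_nat by auto
  \<comment> \<open>The power \<open>p ^ 0\<close> is admissible because \<open>t \<ge> 2\<close>,
    so the greatest admissible power exists.\<close>
  have "(\<exists>i. 1 = p ^ i) \<and> 1 \<le> t - 1"
    using assms(4) by (auto intro: exI[of _ 0])
  then have "(\<exists>i. q = p ^ i) \<and> q \<le> t - 1"
    unfolding assms(5) by (rule GreatestI_nat[where b = "t - 1"]) auto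
  then obtain e where q: "q = CHAR('a) ^ e" "q < t"
    using assms(3,4) by auto
  \<comment> \<open>Since \<open>p ^ t\<close> exceeds \<open>t\<close>, there is an admissible
    power for \<open>q2\<close>.\<close>
  have "(\<exists>i. p ^ t = p ^ i) \<and> t \<le> q + p ^ t"
    using p(2) power_gt_expt[of p t] by auto
  then have "(\<exists>i. q2 = p ^ i) \<and> t \<le> q + q2"
    unfolding assms(6) by (rule LeastI)
  then obtain e' where q2: "q2 = CHAR('a) ^ e'" "t \<le> q + q2"
    using assms(3) by auto
  have rank: "enat (2 * (q div q2) - 1) \<le> vs_rank F (H_thickening 3 t 0)"
    unfolding assms(1) using p(1) q(1) q2(1) q(2) q2(2) by (rule vs_rank_H_thickening_ge)
  \<comment> \<open>Here \<open>q = t - 1\<close> and \<open>q2 = 1\<close>, so the general bound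
    reads \<open>2 * (t - 1) - 1\<close>.\<close>
  moreover have "enat (2 * t - 3) \<le> vs_rank F (H_thickening 3 t 0)" if t: "t = p ^ e0 + 1" for e0
  proof -
    have "q = p ^ e0"
      unfolding assms(5) by (rule Greatest_equality) (use t in auto)
    moreover have "q2 = 1"
      unfolding assms(6) by (rule Least_equality) (use t calculation p(2) in \<open>auto intro: exI[of _ 0]\<close>)
    ultimately show ?thesis
      using rank t by (simp add: algebra_simps)
  qed
  ultimately show ?thesis by blast
qed

end
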